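(* Let $\kappa$ be an algebraically closed field of characteristic zero, complete for a non-trivial non-Archimedean absolute value. Let $n$ be a positive integer and let $\Omega(X_0,\dots,X_n)=\sum_{i\in I}c_iX_0^{i_0}\cdots X_n^{i_n}$ be a non-zero polynomial with coefficients $c_i\in\mathcal{M}(\kappa)$. Let $f\in\mathcal{M}(\kappa)$ be non-constant with $$\Omega(f,f',\dots,f^{(n)})=0$$ and admissible, i.e. $\sum_{i\in I}T(r,c_i)=o(T(r,f))$ as $r\to\infty$. If $a\in\mathcal{M}(\kappa)$ satisfies $T(r,a)=o(T(r,f))$ and $\Omega(a,a',\dots,a^{(n)})\not\equiv0$, then $$m\!\left(r,\frac1{f-a}\right)=o(T(r,f))\quad(r\to\infty).$$
   Context: $\mathcal{M}(\kappa)$ is the field of meromorphic functions over $\kappa$ (quotients of power series converging on all of $\kappa$). For entire $g=\sum a_nz^n$, $\mu(r,g)=\max_n|a_n|r^n$, and for $f=g/h$, $\mu(r,f)=\mu(r,g)/\mu(r,h)$; $m(r,f)=\log^+\mu(r,f)$; $N(r,f)=\int_0^r\frac{n(t,f)-n(0,f)}{t}dt+n(0,f)\log r$ where $n(t,f)$ counts poles in $|z|\le t$ with multiplicity; $T(r,f)=m(r,f)+N(r,f)$. *)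

theory Defs
  imports "HOL-Analysis.Analysis" "HOL-Computational_Algebra.Polynomial"
    "HOL-Computational_Algebra.Formal_Laurent_Series" "HOL-Library.Landau_Symbols"
begin

definition vlim :: "('k::ab_group_add \<Rightarrow> real) \<Rightarrow> (nat \<Rightarrow> 'k) \<Rightarrow> 'k \<Rightarrow> bool" where
  "vlim v s L \<longleftrightarrow> (\<lambda>N. v (s N - L)) \<longlonglongrightarrow> 0"

definition vcauchy :: "('k::ab_group_add \<Rightarrow> real) \<Rightarrow> (nat \<Rightarrow> 'k) \<Rightarrow> bool" where
  "vcauchy v s \<longleftrightarrow> (\<forall>e>0. \<exists>N. \<forall>m\<ge>N. \<forall>k\<ge>N. v (s m - s k) < e)"

definition complete_nonarch_abs :: "('k::field \<Rightarrow> real) \<Rightarrow> bool" where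
  "complete_nonarch_abs v \<longleftrightarrow>
     (\<forall>x. v x \<ge> 0) \<and> (\<forall>x. v x = 0 \<longleftrightarrow> x = 0) \<and>
     (\<forall>x y. v (x * y) = v x * v y) \<and>
     (\<forall>x y. v (x + y) \<le> max (v x) (v y)) \<and>
     (\<exists>x. x \<noteq> 0 \<and> v x \<noteq> 1) \<and>
     (\<forall>s. vcauchy v s \<longrightarrow> (\<exists>L. vlim v s L))"

definition alg_closed_field :: "'k::field itself \<Rightarrow> bool" where
  "alg_closed_field _ \<longleftrightarrow> (\<forall>p :: 'k poly. degree p \<ge> 1 \<longrightarrow> (\<exists>x. poly p x = 0))"

definition vsum :: "('k::field \<Rightarrow> real) \<Rightarrow> (nat \<Rightarrow> 'k) \<Rightarrow> 'k" where
  "vsum v a = (THE L. vlim v (\<lambda>N. \<Sum>n<N. a n) L)"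

definition entire :: "('k::field \<Rightarrow> real) \<Rightarrow> 'k fps \<Rightarrow> bool" where
  "entire v g \<longleftrightarrow> (\<forall>z. \<exists>L. vlim v (\<lambda>N. \<Sum>n<N. fps_nth g n * z ^ n) L)"

text \<open>Meromorphic functions, viewed inside the field of formal Laurent series (at 0)
  as quotients of entire functions.\<close>
definition merom :: "('k::field \<Rightarrow> real) \<Rightarrow> 'k fls set" where
  "merom v = {f. \<exists>g h. entire v g \<and> entire v h \<and> h \<noteq> 0 \<and> f = fps_to_fls g / fps_to_fls h}"

definition mu_entire :: "('k::field \<Rightarrow> real) \<Rightarrow> real \<Rightarrow> 'k fps \<Rightarrow> real" where
  "mu_entire v r g = (SUP n. v (fps_nth g n) * r ^ n)"

definition mu :: "('k::field \<Rightarrow> real) \<Rightarrow> real \<Rightarrow> 'k fls \<Rightarrow> real" where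
  "mu v r f = (SOME q. \<exists>g h. entire v g \<and> entire v h \<and> h \<noteq> 0 \<and>
       f = fps_to_fls g / fps_to_fls h \<and> q = mu_entire v r g / mu_entire v r h)"

definition m_prox :: "('k::field \<Rightarrow> real) \<Rightarrow> real \<Rightarrow> 'k fls \<Rightarrow> real" where
  "m_prox v r f = max 0 (ln (mu v r f))"

definition taylor_coeff :: "('k::field \<Rightarrow> real) \<Rightarrow> 'k fps \<Rightarrow> 'k \<Rightarrow> nat \<Rightarrow> 'k" where
  "taylor_coeff v g z0 k = vsum v (\<lambda>n. of_nat (n choose k) * fps_nth g n * z0 ^ (n - k))"

definition zero_order :: "('k::field \<Rightarrow> real) \<Rightarrow> 'k fps \<Rightarrow> 'k \<Rightarrow> nat" where
  "zero_order v g z0 = (LEAST k. taylor_coeff v g z0 k \<noteq> 0)"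

text \<open>Multiplicity of z0 as a pole of f (0 if z0 is not a pole).\<close>
definition pole_mult :: "('k::field \<Rightarrow> real) \<Rightarrow> 'k fls \<Rightarrow> 'k \<Rightarrow> nat" where
  "pole_mult v f z0 = (if f = 0 then 0 else
     (SOME m. \<exists>g h. entire v g \<and> entire v h \<and> h \<noteq> 0 \<and> g \<noteq> 0 \<and>
        f = fps_to_fls g / fps_to_fls h \<and>
        m = nat (int (zero_order v h z0) - int (zero_order v g z0))))"

definition n_poles :: "('k::field \<Rightarrow> real) \<Rightarrow> real \<Rightarrow> 'k fls \<Rightarrow> real" where
  "n_poles v t f = real (\<Sum>z\<in>{z. v z \<le> t \<and> pole_mult v f z \<noteq> 0}. pole_mult v f z)"

definition N_count :: "('k::field \<Rightarrow> real) \<Rightarrow> real \<Rightarrow> 'k fls \<Rightarrow> real" where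
  "N_count v r f = integral {0..r} (\<lambda>t. (n_poles v t f - n_poles v 0 f) / t)
                   + n_poles v 0 f * ln r"

definition T_char :: "('k::field \<Rightarrow> real) \<Rightarrow> real \<Rightarrow> 'k fls \<Rightarrow> real" where
  "T_char v r f = m_prox v r f + N_count v r f"

text \<open>Omega(f, f', ..., f^(n)) = sum_{i in I} c_i prod_{j<=n} (f^(j))^(i_j);
  multi-indices are functions nat => nat supported in {0..n}.\<close>
definition diff_poly_eval :: "nat \<Rightarrow> (nat \<Rightarrow> nat) set \<Rightarrow> ((nat \<Rightarrow> nat) \<Rightarrow> 'k::field fls) \<Rightarrow> 'k fls \<Rightarrow> 'k fls" where
  "diff_poly_eval n I c f = (\<Sum>i\<in>I. c i * (\<Prod>j\<le>n. ((fls_deriv ^^ j) f) ^ (i j)))"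

end

theory Submission
  imports Defs
begin

text \<open>
  For \<open>r \<ge> 1\<close> the map \<open>mu v r\<close> is a non-Archimedean absolute value on the meromorphic functions
  which differentiation does not increase. Put \<open>g = f - a\<close>. If \<open>mu v r g < 1\<close>, every derivative of \<open>f\<close>
  is within \<open>mu v r g\<close> of that of \<open>a\<close>, so \<open>\<Omega>(a) = \<Omega>(a) - \<Omega>(f)\<close> is bounded by \<open>mu v r g\<close> times a product of
  powers of \<open>max 1 (mu v r (c i))\<close> and \<open>max 1 (mu v r a)\<close>. Hence \<open>m(r, 1/g)\<close> is at most a combination of the
  \<open>m(r, c i)\<close> and \<open>m(r, a)\<close> plus \<open>- ln (mu v r \<Omega>(a))\<close>, and Jensen's formula bounds the latter by
  \<open>N(r, \<Omega>(a)) + O(1)\<close>, which is controlled by the poles of the \<open>c i\<close> and of \<open>a\<close>. Jensen's formula also shows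
  that \<open>T(r, f)\<close> tends to infinity, which absorbs the \<open>O(1)\<close>.

  Jensen's formula itself rests on counting: the number of zeros of an entire \<open>g\<close> in the disc of radius
  \<open>r\<close> is the last index at which \<open>v (fps_nth g k) * r ^ k\<close> is maximal. For polynomials this is Gauss's lemma;
  for entire series the zeros arise as limits of zeros of the truncations.
\<close>

section \<open>Non-Archimedean absolute values\<close>

text \<open>Meromorphic functions are formal Laurent series at the origin, while \<open>mu\<close>
  and \<open>pole_mult\<close> choose a representation as a quotient of entire series. Independence
  of the representation has to be proved, and a function must be made visible near points other than
  the origin. For \<open>mu\<close> the former is multiplicativity of the Gauss norm. Everything
  local rests on the Taylor shift \<open>shift z\<close>, whose coefficients are infinite sums: that
  it is an injective ring homomorphism commuting with differentiation is checked on monomials and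
  extended by continuity in the Gauss norm. After that a multiplicity is a subdegree, and bounding
  the poles of \<Omega>(a) is formal algebra with Laurent series. The range \<open>r \<ge> 1\<close>
  has two sources: differentiation scales the Gauss norm by at most \<open>1 / r\<close>, and a pole
  at the origin is counted with weight \<open>ln r\<close>. Multiples of T(r, a) are harmless, since
  T(r, a) is o(T(r, f)); this permits crude constants, with sums in place of maxima.\<close>

lemma null_squeeze:
  fixes s h :: "nat \<Rightarrow> real"
  assumes "h \<longlonglongrightarrow> 0" "\<And>n. s n \<le> h n" "\<And>n. 0 \<le> s n"
  shows "s \<longlonglongrightarrow> 0"
  by (rule tendsto_sandwich[of "\<lambda>_. 0" _ _ h]) (use assms in auto)

locale nonarch =
  fixes v :: "'k::field_char_0 \<Rightarrow> real"
  assumes complete_nonarch: "complete_nonarch_abs v"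
begin

lemma v_nonneg [simp]: "0 \<le> v x"
  and v_eq_0_iff [simp]: "v x = 0 \<longleftrightarrow> x = 0"
  and v_mult: "v (x * y) = v x * v y"
  and v_add_le_max: "v (x + y) \<le> max (v x) (v y)"
  and v_nontrivial: "\<exists>x. x \<noteq> 0 \<and> v x \<noteq> 1"
  and v_complete: "vcauchy v s \<Longrightarrow> \<exists>L. vlim v s L"
proof -
  note * = complete_nonarch[unfolded complete_nonarch_abs_def]
  show "0 \<le> v x" using * by (elim conjE) (erule spec)
  show "v x = 0 \<longleftrightarrow> x = 0" using * by (elim conjE) (erule spec)
  show "v (x * y) = v x * v y" using * by (elim conjE) metis
  show "v (x + y) \<le> max (v x) (v y)" using * by (elim conjE) metis
  show "\<exists>x. x \<noteq> 0 \<and> v x \<noteq> 1" using * by (elim conjE)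
  show "vcauchy v s \<Longrightarrow> \<exists>L. vlim v s L" using * by (elim conjE) metis
qed

lemma v_0 [simp]: "v 0 = 0"
  by simp

lemma v_pos_iff [simp]: "0 < v x \<longleftrightarrow> x \<noteq> 0"
  using v_nonneg[of x] v_eq_0_iff[of x] by linarith

lemma v_1 [simp]: "v 1 = 1"
  using v_mult[of 1 1] v_eq_0_iff[of 1] by simp

lemma v_minus [simp]: "v (- x) = v x"
proof -
  have "v (-1) * v (-1) = 1"
    using v_mult[of "-1" "-1"] by simp
  then have "v (-1) = 1"
    using v_nonneg[of "-1"] by (simp add: square_eq_1_iff)
  then show ?thesis
    using v_mult[of "-1" x] by simp
qed

lemma v_diff_commute: "v (x - y) = v (y - x)"
  using v_minus[of "x - y"] by simp

lemma v_diff_le_max: "v (x - y) \<le> max (v x) (v y)"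
  using v_add_le_max[of x "- y"] by simp

lemma v_add_le: "v (x + y) \<le> v x + v y"
  by (rule order_trans[OF v_add_le_max]) simp

lemma v_diff_le: "v (x - y) \<le> v x + v y"
  by (rule order_trans[OF v_diff_le_max]) simp

lemma v_power: "v (x ^ n) = v x ^ n"
  by (induction n) (simp_all add: v_mult)

lemma v_inverse: "v (inverse x) = inverse (v x)"
proof (cases "x = 0")
  case False
  then have "v x * v (inverse x) = 1"
    using v_mult[of x "inverse x"] by simp
  then show ?thesis
    by (simp add: inverse_unique)
qed simp

lemma v_sum_le: "0 \<le> B \<Longrightarrow> (\<And>i. i \<in> A \<Longrightarrow> v (h i) \<le> B) \<Longrightarrow> v (sum h A) \<le> B"
proof (induction A rule: infinite_finite_induct)
  case (insert x F)
  have "v (h x) \<le> B" "v (sum h F) \<le> B"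
    using insert.prems insert.IH by simp_all
  then show ?case
    using v_add_le_max[of "h x" "sum h F"] insert.hyps by simp
qed simp_all

lemma v_sum_less: "0 < B \<Longrightarrow> (\<And>i. i \<in> A \<Longrightarrow> v (h i) < B) \<Longrightarrow> v (sum h A) < B"
proof (induction A rule: infinite_finite_induct)
  case (insert x F)
  have "v (h x) < B" "v (sum h F) < B"
    using insert.prems insert.IH by simp_all
  then show ?case
    using v_add_le_max[of "h x" "sum h F"] insert.hyps by simp
qed simp_all

text \<open>Writing \<open>x\<close> as \<open>(x + y) - y\<close>, the bound on \<open>v x\<close>
  cannot come from the smaller \<open>v y\<close>.\<close>

lemma v_add_eq:
  assumes "v y < v x"
  shows "v (x + y) = v x"
proof -
  have "v x \<le> max (v (x + y)) (v y)"
    using v_diff_le_max[of "x + y" y] by simp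
  then show ?thesis
    using assms v_add_le_max[of x y] by linarith
qed

text \<open>The ultrametric inequality iterated from \<open>v 1 = 1\<close>. This makes the binomial
  coefficients in Taylor shifts and the integer factors produced by differentiation
  harmless.\<close>

lemma v_of_nat_le: "v (of_nat n) \<le> 1"
proof (induction n)
  case (Suc n)
  then show ?case
    using v_add_le_max[of 1 "of_nat n"] by simp
qed simp

lemma ex_v_ge: "\<exists>z. z \<noteq> 0 \<and> v z \<ge> r"
proof -
  obtain x where x: "x \<noteq> 0" "v x \<noteq> 1"
    using v_nontrivial by blast
  \<comment> \<open>One of \<open>x\<close> and its inverse has absolute value above 1, and its
    powers are unbounded.\<close>
  define y where "y = (if v x > 1 then x else inverse x)"
  have y: "y \<noteq> 0" "v y > 1"
    using x by (auto simp: y_def v_inverse one_less_inverse_iff)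
  obtain n where "v y ^ n > r"
    using real_arch_pow[OF y(2)] by blast
  then show ?thesis
    using y(1) by (intro exI[of _ "y ^ n"]) (simp add: v_power)
qed

section \<open>Limits and convergent series for a complete ultrametric absolute value\<close>

lemma vlim_unique:
  assumes "vlim v s L" "vlim v s M"
  shows "L = M"
proof -
  have "(\<lambda>N. v (s N - M) + v (s N - L)) \<longlonglongrightarrow> 0 + 0"
    using assms unfolding vlim_def by (intro tendsto_add)
  moreover have "v (L - M) \<le> v (s N - M) + v (s N - L)" for N
    using v_diff_le[of "s N - M" "s N - L"] by simp
  ultimately have "v (L - M) \<le> 0"
    by (intro LIMSEQ_le_const[of "\<lambda>N. v (s N - M) + v (s N - L)"]) auto
  then have "v (L - M) = 0"
    using v_nonneg[of "L - M"] by linarith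
  then show ?thesis
    by simp
qed

lemma vlim_squeeze:
  assumes "\<And>N. v (s N - L) \<le> h N" "h \<longlonglongrightarrow> 0"
  shows "vlim v s L"
  unfolding vlim_def
  by (rule null_squeeze[OF assms(2)]) (use assms in auto)

lemma vlim_add:
  assumes "vlim v s L" "vlim v t M"
  shows "vlim v (\<lambda>N. s N + t N) (L + M)"
proof (rule vlim_squeeze)
  show "v (s N + t N - (L + M)) \<le> v (s N - L) + v (t N - M)" for N
    using v_add_le[of "s N - L" "t N - M"]
    by (simp add: algebra_simps)
  show "(\<lambda>N. v (s N - L) + v (t N - M)) \<longlonglongrightarrow> 0"
    using assms tendsto_add unfolding vlim_def by fastforce
qed

lemma vlim_v_le:
  assumes "vlim v s L" "\<And>N. v (s N) \<le> B"
  shows "v L \<le> B"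
proof (rule field_le_epsilon)
  fix e :: real assume "0 < e"
  then obtain N where N: "v (s N - L) < e"
    using order_tendstoD(2)[OF assms(1)[unfolded vlim_def]] by (auto simp: eventually_sequentially)
  show "v L \<le> B + e"
    using v_diff_le[of "s N" "s N - L"] N assms(2)[of N] by simp
qed

text \<open>A difference of two late members telescopes, and its absolute value is at most the
  largest increment. Hence null increments already give a Cauchy sequence.\<close>

lemma vlim_convergent:
  assumes "(\<lambda>n. v (s (Suc n) - s n)) \<longlonglongrightarrow> 0"
  shows "\<exists>L. vlim v s L"
proof (rule v_complete, unfold vcauchy_def, intro allI impI)
  fix e :: real assume "0 < e"
  then obtain N where N: "\<And>n. n \<ge> N \<Longrightarrow> v (s (Suc n) - s n) < e"
    using order_tendstoD(2)[OF assms] by (auto simp: eventually_sequentially)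
  have *: "v (s (N + d) - s N) < e" for d
  proof (induction d)
    case (Suc d)
    then show ?case
      using v_add_le_max[of "s (Suc (N + d)) - s (N + d)" "s (N + d) - s N"] N[of "N + d"] by simp
  qed (use \<open>0 < e\<close> in simp)
  have "v (s m - s k) < e" if "m \<ge> N" "k \<ge> N" for m k
    using v_diff_le_max[of "s m - s N" "s k - s N"] *[of "m - N"] *[of "k - N"] that by simp
  then show "\<exists>N. \<forall>m\<ge>N. \<forall>k\<ge>N. v (s m - s k) < e"
    by blast
qed

lemma vsum_vlim:
  assumes "(\<lambda>n. v (a n)) \<longlonglongrightarrow> 0"
  shows "vlim v (\<lambda>N. \<Sum>n<N. a n) (vsum v a)"
proof -
  obtain L where L: "vlim v (\<lambda>N. \<Sum>n<N. a n) L"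
    using vlim_convergent[of "\<lambda>N. \<Sum>n<N. a n"] assms by auto
  then show ?thesis
    unfolding vsum_def by (rule theI) (use L vlim_unique in blast)
qed

lemma vsum_eqI: "vlim v (\<lambda>N. \<Sum>n<N. a n) L \<Longrightarrow> vsum v a = L"
  unfolding vsum_def by (rule the_equality) (simp_all add: vlim_unique)

lemma vsum_add:
  assumes "(\<lambda>n. v (a n)) \<longlonglongrightarrow> 0" "(\<lambda>n. v (b n)) \<longlonglongrightarrow> 0"
  shows "vsum v (\<lambda>n. a n + b n) = vsum v a + vsum v b"
  unfolding vsum_eqI[OF vlim_add[OF vsum_vlim[OF assms(1)] vsum_vlim[OF assms(2)], folded sum.distrib]] ..

lemma v_vsum_le:
  assumes "(\<lambda>n. v (a n)) \<longlonglongrightarrow> 0" "\<And>n. v (a n) \<le> B"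
  shows "v (vsum v a) \<le> B"
proof -
  have "0 \<le> B"
    using assms(2)[of 0] v_nonneg[of "a 0"] by linarith
  then show ?thesis
    by (intro vlim_v_le[OF vsum_vlim[OF assms(1)]] v_sum_le assms(2))
qed

lemma vsum_finite:
  assumes "\<And>n. n \<ge> K \<Longrightarrow> a n = 0"
  shows "vsum v a = (\<Sum>n<K. a n)"
proof (rule vsum_eqI)
  have "v ((\<Sum>n<N. a n) - (\<Sum>n<K. a n)) = 0" if "N \<ge> K" for N
  proof -
    have "(\<Sum>n<N. a n) = (\<Sum>n<K. a n)"
      using assms that by (intro sum.mono_neutral_right) auto
    then show ?thesis
      by simp
  qed
  then have "eventually (\<lambda>N. v ((\<Sum>n<N. a n) - (\<Sum>n<K. a n)) = 0) sequentially"
    unfolding eventually_sequentially by blast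
  then show "vlim v (\<lambda>N. \<Sum>n<N. a n) (\<Sum>n<K. a n)"
    unfolding vlim_def by (rule tendsto_eventually)
qed

text \<open>A real radius \<open>r\<close> need not be an absolute value, so a point
  \<open>z\<close> with \<open>v z \<ge> r\<close> replaces it. There each term is a difference of
  consecutive partial sums, hence null; conversely null terms suffice for convergence.\<close>

lemma entire_iff: "entire v g \<longleftrightarrow> (\<forall>r>0. (\<lambda>n. v (fps_nth g n) * r ^ n) \<longlonglongrightarrow> 0)"
proof (intro iffI allI impI)
  fix r :: real assume g: "entire v g" and r: "0 < r"
  obtain z where z: "v z \<ge> r"
    using ex_v_ge by blast
  define s where "s = (\<lambda>N. \<Sum>n<N. fps_nth g n * z ^ n)"
  obtain L where "vlim v s L"
    using g unfolding entire_def s_def by blast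
  then have L: "(\<lambda>N. v (s N - L)) \<longlonglongrightarrow> 0"
    unfolding vlim_def .
  have "(\<lambda>N. v (s (Suc N) - L) + v (s N - L)) \<longlonglongrightarrow> 0"
    using tendsto_add[OF LIMSEQ_Suc[OF L] L] by simp
  moreover have "v (fps_nth g N) * r ^ N \<le> v (s (Suc N) - L) + v (s N - L)" for N
  proof -
    have "v (fps_nth g N) * r ^ N \<le> v (fps_nth g N) * v z ^ N"
      using r z by (intro mult_left_mono power_mono) auto
    also have "\<dots> = v ((s (Suc N) - L) - (s N - L))"
      by (simp add: s_def v_mult v_power)
    also have "\<dots> \<le> v (s (Suc N) - L) + v (s N - L)"
      by (rule v_diff_le)
    finally show ?thesis .
  qed
  ultimately show "(\<lambda>n. v (fps_nth g n) * r ^ n) \<longlonglongrightarrow> 0"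
    by (rule null_squeeze) (use r in simp)
next
  assume *: "\<forall>r>0. (\<lambda>n. v (fps_nth g n) * r ^ n) \<longlonglongrightarrow> 0"
  show "entire v g"
    unfolding entire_def
  proof
    fix z
    define r where "r = max 1 (v z)"
    have "0 < r"
      by (simp add: r_def)
    then have "(\<lambda>n. v (fps_nth g n) * r ^ n) \<longlonglongrightarrow> 0"
      using * by blast
    moreover have "v (fps_nth g n * z ^ n) \<le> v (fps_nth g n) * r ^ n" for n
      unfolding v_mult v_power by (intro mult_left_mono power_mono) (auto simp: r_def)
    ultimately have "(\<lambda>n. v (fps_nth g n * z ^ n)) \<longlonglongrightarrow> 0"
      by (rule null_squeeze) simp
    then show "\<exists>L. vlim v (\<lambda>N. \<Sum>n<N. fps_nth g n * z ^ n) L"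
      using vsum_vlim[of "\<lambda>n. fps_nth g n * z ^ n"] by blast
  qed
qed

lemma entire_tendsto: "entire v g \<Longrightarrow> 0 < r \<Longrightarrow> (\<lambda>n. v (fps_nth g n) * r ^ n) \<longlonglongrightarrow> 0"
  by (simp add: entire_iff)

end

section \<open>Entire series and the Gauss norm\<close>

context nonarch
begin

text \<open>A bound at radius \<open>2 * r\<close> gives geometric decay at radius \<open>r\<close>.
  Bounds are easier to carry through products, shifts and derivatives than limits.\<close>

lemma entire_iff_bounded: "entire v g \<longleftrightarrow> (\<forall>r>0. \<exists>B. \<forall>n. v (fps_nth g n) * r ^ n \<le> B)"
proof (intro iffI allI impI)
  fix r :: real assume "entire v g" "0 < r"
  then have "Bseq (\<lambda>n. v (fps_nth g n) * r ^ n)"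
    by (intro convergent_imp_Bseq convergentI[of _ 0] entire_tendsto)
  then obtain B where B: "\<forall>n. norm (v (fps_nth g n) * r ^ n) \<le> B"
    by (auto simp only: Bseq_def)
  have "v (fps_nth g n) * r ^ n \<le> B" for n
    using B[rule_format, of n] by (simp only: real_norm_def abs_le_iff)
  then show "\<exists>B. \<forall>n. v (fps_nth g n) * r ^ n \<le> B"
    by blast
next
  assume *: "\<forall>r>0. \<exists>B. \<forall>n. v (fps_nth g n) * r ^ n \<le> B"
  show "entire v g"
    unfolding entire_iff
  proof (intro allI impI)
    fix r :: real assume r: "0 < r"
    obtain B where B: "\<And>n. v (fps_nth g n) * (2 * r) ^ n \<le> B"
      using *[rule_format, of "2 * r"] r by auto
    have "(\<lambda>n. B * (1 / 2) ^ n) \<longlonglongrightarrow> 0"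
      by (intro tendsto_mult_right_zero LIMSEQ_realpow_zero) auto
    moreover have "v (fps_nth g n) * r ^ n \<le> B * (1 / 2) ^ n" for n
      using B[of n] by (simp add: power_mult_distrib field_simps)
    ultimately show "(\<lambda>n. v (fps_nth g n) * r ^ n) \<longlonglongrightarrow> 0"
      by (rule null_squeeze) (use r in simp)
  qed
qed

lemma entireI: "(\<And>r. 0 < r \<Longrightarrow> \<exists>B. \<forall>n. v (fps_nth g n) * r ^ n \<le> B) \<Longrightarrow> entire v g"
  by (simp add: entire_iff_bounded)

lemma entire_bounded:
  assumes "entire v g" "0 < r"
  shows "\<exists>B\<ge>0. \<forall>n. v (fps_nth g n) * r ^ n \<le> B"
proof -
  obtain B where B: "\<And>n. v (fps_nth g n) * r ^ n \<le> B"
    using assms unfolding entire_iff_bounded by metis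
  moreover have "0 \<le> B"
    using B[of 0] order_trans[OF v_nonneg[of "fps_nth g 0"]] by simp
  ultimately show ?thesis
    by blast
qed

lemma mu_entire_ge:
  assumes "entire v g" "0 < r"
  shows "v (fps_nth g n) * r ^ n \<le> mu_entire v r g"
proof -
  obtain B where "0 \<le> B" "\<And>n. v (fps_nth g n) * r ^ n \<le> B"
    using entire_bounded[OF assms] by auto
  then show ?thesis
    unfolding mu_entire_def by (intro cSUP_upper bdd_aboveI2[of _ _ B]) simp_all
qed

lemma mu_entire_le: "(\<And>n. v (fps_nth g n) * r ^ n \<le> B) \<Longrightarrow> mu_entire v r g \<le> B"
  unfolding mu_entire_def by (intro cSUP_least) auto

lemma mu_entire_nonneg: "entire v g \<Longrightarrow> 0 < r \<Longrightarrow> 0 \<le> mu_entire v r g"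
  using mu_entire_ge[of g r 0] order_trans[OF v_nonneg[of "fps_nth g 0"]] by simp

lemma mu_entire_0 [simp]: "mu_entire v r 0 = 0"
  by (simp add: mu_entire_def)

lemma mu_entire_add:
  assumes "entire v g" "entire v h" "0 < r"
  shows "mu_entire v r (g + h) \<le> max (mu_entire v r g) (mu_entire v r h)"
proof (rule mu_entire_le)
  fix n
  have "v (fps_nth (g + h) n) * r ^ n \<le> max (v (fps_nth g n)) (v (fps_nth h n)) * r ^ n"
    using assms(3) by (intro mult_right_mono) (simp_all add: v_add_le_max)
  also have "\<dots> = max (v (fps_nth g n) * r ^ n) (v (fps_nth h n) * r ^ n)"
    using assms(3) by (simp add: max_mult_distrib_right)
  also have "\<dots> \<le> max (mu_entire v r g) (mu_entire v r h)"
    using assms by (intro max.mono mu_entire_ge)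
  finally show "v (fps_nth (g + h) n) * r ^ n \<le> max (mu_entire v r g) (mu_entire v r h)" .
qed

lemma mu_entire_minus [simp]: "mu_entire v r (- g) = mu_entire v r g"
  by (simp add: mu_entire_def)

lemma entire_finite:
  assumes "\<And>n. n \<ge> N \<Longrightarrow> fps_nth g n = 0"
  shows "entire v g"
proof (rule entireI, intro exI allI)
  fix r :: real and n assume r: "0 < r"
  show "v (fps_nth g n) * r ^ n \<le> (\<Sum>n<N. v (fps_nth g n) * r ^ n)"
  proof (cases "n < N")
    case True
    then show ?thesis
      using r by (intro member_le_sum) auto
  qed (use r assms in \<open>auto intro!: sum_nonneg\<close>)
qed

lemma entire_0 [simp]: "entire v 0"
  by (rule entire_finite[of 0]) simp

lemma entire_1 [simp]: "entire v 1"
  by (rule entire_finite[of 1]) simp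

lemma entire_const [simp]: "entire v (fps_const c)"
  by (rule entire_finite[of 1]) simp

lemma entire_X [simp]: "entire v fps_X"
  by (rule entire_finite[of 2]) simp

lemma entire_of_poly [simp]: "entire v (fps_of_poly p)"
  by (rule entire_finite[of "Suc (degree p)"]) (simp add: coeff_eq_0)

lemma entire_add [simp, intro]:
  assumes "entire v g" "entire v h"
  shows "entire v (g + h)"
proof (rule entireI)
  fix r :: real assume r: "0 < r"
  obtain B where B: "0 \<le> B" "\<And>n. v (fps_nth g n) * r ^ n \<le> B"
    using entire_bounded[OF assms(1) r] by auto
  obtain C where C: "0 \<le> C" "\<And>n. v (fps_nth h n) * r ^ n \<le> C"
    using entire_bounded[OF assms(2) r] by auto
  have "v (fps_nth (g + h) n) * r ^ n \<le> B + C" for n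
  proof -
    have "v (fps_nth (g + h) n) * r ^ n \<le> (v (fps_nth g n) + v (fps_nth h n)) * r ^ n"
      using r by (intro mult_right_mono) (simp_all add: v_add_le)
    then show ?thesis
      using B(2)[of n] C(2)[of n] by (simp add: distrib_right)
  qed
  then show "\<exists>B. \<forall>n. v (fps_nth (g + h) n) * r ^ n \<le> B"
    by blast
qed

lemma entire_minus [simp, intro]: "entire v g \<Longrightarrow> entire v (- g)"
  by (simp add: entire_iff_bounded)

lemma entire_diff [simp, intro]: "entire v g \<Longrightarrow> entire v h \<Longrightarrow> entire v (g - h)"
  using entire_add[of g "- h"] entire_minus[of h] by simp

lemma fps_mult_terms_le:
  assumes "0 < r" "0 \<le> B" "0 \<le> C"
    and "\<And>n. v (fps_nth g n) * r ^ n \<le> B" "\<And>n. v (fps_nth h n) * r ^ n \<le> C"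
  shows "v (fps_nth (g * h) n) * r ^ n \<le> B * C"
proof -
  have "v (fps_nth g i * fps_nth h (n - i)) \<le> B * C / r ^ n" if "i \<in> {0..n}" for i
  proof -
    have "(v (fps_nth g i) * r ^ i) * (v (fps_nth h (n - i)) * r ^ (n - i)) \<le> B * C"
      using assms by (intro mult_mono) auto
    moreover have "r ^ n = r ^ i * r ^ (n - i)"
      using that by (simp flip: power_add)
    ultimately show ?thesis
      using assms(1) by (simp add: v_mult field_simps)
  qed
  then have "v (fps_nth (g * h) n) \<le> B * C / r ^ n"
    unfolding fps_mult_nth using assms by (intro v_sum_le) auto
  then show ?thesis
    using assms(1) by (simp add: field_simps)
qed

lemma entire_mult [simp, intro]:
  assumes "entire v g" "entire v h"
  shows "entire v (g * h)"
proof (rule entireI)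
  fix r :: real assume r: "0 < r"
  obtain B where B: "0 \<le> B" "\<And>n. v (fps_nth g n) * r ^ n \<le> B"
    using entire_bounded[OF assms(1) r] by auto
  obtain C where C: "0 \<le> C" "\<And>n. v (fps_nth h n) * r ^ n \<le> C"
    using entire_bounded[OF assms(2) r] by auto
  show "\<exists>B. \<forall>n. v (fps_nth (g * h) n) * r ^ n \<le> B"
    using fps_mult_terms_le[OF r B(1) C(1) B(2) C(2)] by blast
qed

lemma entire_power [simp, intro]: "entire v g \<Longrightarrow> entire v (g ^ n)"
  by (induction n) auto

text \<open>The integer factor has absolute value at most 1, and lowering the index by one costs
  exactly one power of \<open>r\<close>.\<close>

lemma mu_entire_deriv:
  assumes "entire v g" "0 < r"
  shows "v (fps_nth (fps_deriv g) n) * r ^ n \<le> mu_entire v r g / r"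
proof -
  have "v (fps_nth (fps_deriv g) n) * r ^ n * r = v (of_nat (Suc n)) * (v (fps_nth g (Suc n)) * r ^ Suc n)"
    by (simp add: v_mult)
  also have "\<dots> \<le> 1 * (v (fps_nth g (Suc n)) * r ^ Suc n)"
    using assms(2) by (intro mult_right_mono v_of_nat_le) simp
  also have "\<dots> \<le> mu_entire v r g"
    using mu_entire_ge[OF assms, of "Suc n"] by simp
  finally show ?thesis
    using assms(2) by (simp add: field_simps)
qed

lemma entire_deriv [simp, intro]: "entire v g \<Longrightarrow> entire v (fps_deriv g)"
  by (rule entireI) (use mu_entire_deriv in blast)

text \<open>The Newton polygon datum at radius \<open>r\<close>: the last index \<open>k\<close> at which the maximum \<open>m\<close> of
  the terms is attained. It turns out to be the number of zeros in the closed disc.\<close>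
definition dominant :: "real \<Rightarrow> 'k fps \<Rightarrow> nat \<Rightarrow> real \<Rightarrow> bool" where
  "dominant r g k m \<longleftrightarrow> 0 < m \<and> v (fps_nth g k) * r ^ k = m \<and>
     (\<forall>n. v (fps_nth g n) * r ^ n \<le> m) \<and> (\<forall>n>k. v (fps_nth g n) * r ^ n < m)"

text \<open>The terms tend to 0, so the maximum is decided on a finite range and attained only
  finitely often.\<close>

lemma ex_dominant:
  assumes "entire v g" "g \<noteq> 0" "0 < r"
  shows "\<exists>k m. dominant r g k m"
proof -
  define A where "A = (\<lambda>n. v (fps_nth g n) * r ^ n)"
  obtain l where l: "fps_nth g l \<noteq> 0"
    using assms(2) by (auto simp: fps_eq_iff)
  have Al: "0 < A l"
    using l assms(3) by (simp add: A_def)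
  have "eventually (\<lambda>n. A n < A l) sequentially"
    using order_tendstoD(2)[OF entire_tendsto[OF assms(1,3)] Al[unfolded A_def]] by (simp add: A_def)
  then obtain N where N: "\<And>n. n \<ge> N \<Longrightarrow> A n < A l"
    unfolding eventually_sequentially by blast
  \<comment> \<open>The range is extended to contain \<open>l\<close>, so that \<open>m\<close> is
    at least \<open>A l\<close> and exceeds every term from \<open>N\<close> on.\<close>
  define m where "m = Max (A ` {..N + l})"
  have Am: "A n \<le> m" if "n \<le> N + l" for n
    unfolding m_def using that by (intro Max_ge) auto
  have ml: "A l \<le> m"
    by (rule Am) simp
  have small: "A n < m" if "n \<ge> N" for n
    using N[OF that] ml by linarith
  have le: "A n \<le> m" for n
    using Am[of n] small[of n] by (cases "n \<le> N + l") auto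
  have "m \<in> A ` {..N + l}"
    unfolding m_def by (intro Max_in) auto
  then obtain j where j: "A j = m"
    by auto
  define k where "k = (GREATEST n. A n = m)"
  have bd: "\<And>n. A n = m \<Longrightarrow> n \<le> N"
    using small by (metis less_irrefl nat_le_linear)
  have "A k = m"
    unfolding k_def by (rule GreatestI_nat[of _ j]) (use j bd in auto)
  moreover have "A n < m" if "n > k" for n
  proof -
    have "A n \<noteq> m"
      using Greatest_le_nat[of "\<lambda>n. A n = m" n N] bd that unfolding k_def by fastforce
    then show ?thesis
      using le[of n] by simp
  qed
  ultimately show ?thesis
    using le less_le_trans[OF Al ml] unfolding dominant_def A_def
    by (intro exI[of _ k] exI[of _ m]) auto
qed

lemma dominant_mu_entire: "dominant r g k m \<Longrightarrow> mu_entire v r g = m"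
  unfolding mu_entire_def dominant_def by (intro cSup_eq_maximum) auto

lemma dominant_unique: "dominant r g k m \<Longrightarrow> dominant r g l m' \<Longrightarrow> k = l \<and> m = m'"
  using dominant_mu_entire[of r g k m] dominant_mu_entire[of r g l m']
  unfolding dominant_def by (metis less_irrefl linorder_neqE_nat)

lemma mu_entire_pos: "entire v g \<Longrightarrow> g \<noteq> 0 \<Longrightarrow> 0 < r \<Longrightarrow> 0 < mu_entire v r g"
  using ex_dominant[of g r] dominant_mu_entire unfolding dominant_def by metis

text \<open>Gauss's lemma with the index recorded: norms multiply and the last maximal indices add.
  The first fact makes \<open>mu\<close> multiplicative, the second makes the index behave like a
  count of zeros.\<close>

lemma dominant_mult:
  assumes g: "dominant r g k m" and h: "dominant r h l m'" and r: "0 < r"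
  shows "dominant r (g * h) (k + l) (m * m')"
proof -
  define A where "A = (\<lambda>n. v (fps_nth g n) * r ^ n)"
  define B where "B = (\<lambda>n. v (fps_nth h n) * r ^ n)"
  have A: "0 < m" "A k = m" "\<And>n. A n \<le> m" "\<And>n. n > k \<Longrightarrow> A n < m" "\<And>n. 0 \<le> A n"
    using g r unfolding dominant_def A_def by auto
  have B: "0 < m'" "B l = m'" "\<And>n. B n \<le> m'" "\<And>n. n > l \<Longrightarrow> B n < m'" "\<And>n. 0 \<le> B n"
    using h r unfolding dominant_def B_def by auto
  have AB: "v (fps_nth g i * fps_nth h (n - i)) = A i * B (n - i) / r ^ n" if "i \<le> n" for i n
  proof -
    have "r ^ n = r ^ i * r ^ (n - i)"
      using that by (simp flip: power_add)
    then show ?thesis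
      using r by (simp add: v_mult A_def B_def)
  qed
  have lt: "A i * B j < m * m'" if "i > k \<or> j > l" for i j
    using that
  proof
    assume "i > k"
    then have "A i * m' < m * m'"
      using A B by simp
    then show ?thesis
      using mult_left_mono[OF B(3)[of j] A(5)[of i]] by linarith
  next
    assume "j > l"
    then have "m * B j < m * m'"
      using A B by simp
    then show ?thesis
      using mult_right_mono[OF A(3)[of i] B(5)[of j]] by linarith
  qed
  have pos: "0 < m * m' / r ^ n" for n
    using A(1) B(1) r by simp
  have "v (fps_nth (g * h) n) * r ^ n \<le> m * m'" for n
    using A B r by (intro fps_mult_terms_le) (auto simp: A_def B_def)
  moreover have "v (fps_nth (g * h) n) * r ^ n < m * m'" if "n > k + l" for n
  proof -
    have "v (fps_nth (g * h) n) < m * m' / r ^ n"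
      unfolding fps_mult_nth
    proof (rule v_sum_less[OF pos])
      fix i assume i: "i \<in> {0..n}"
      have "A i * B (n - i) < m * m'"
        using that by (intro lt) auto
      then show "v (fps_nth g i * fps_nth h (n - i)) < m * m' / r ^ n"
        using i r by (subst AB) (auto intro: divide_strict_right_mono)
    qed
    then show ?thesis
      using r by (simp add: field_simps)
  qed
  moreover have "v (fps_nth (g * h) (k + l)) * r ^ (k + l) = m * m'"
  proof -
    define n where "n = k + l"
    \<comment> \<open>In coefficient \<open>k + l\<close>, any \<open>i\<close> other than
      \<open>k\<close> has \<open>i > k\<close> or \<open>n - i > l\<close>. A single term thus
      strictly dominates the sum and nothing can cancel it.\<close>
    have "v (\<Sum>i\<in>{0..n} - {k}. fps_nth g i * fps_nth h (n - i)) < m * m' / r ^ n"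
    proof (rule v_sum_less[OF pos])
      fix i assume i: "i \<in> {0..n} - {k}"
      have "A i * B (n - i) < m * m'"
        using i by (intro lt) (auto simp: n_def)
      then show "v (fps_nth g i * fps_nth h (n - i)) < m * m' / r ^ n"
        using i r by (subst AB) (auto intro: divide_strict_right_mono)
    qed
    moreover have "v (fps_nth g k * fps_nth h (n - k)) = m * m' / r ^ n"
      using A B by (subst AB) (auto simp: n_def)
    moreover have "fps_nth (g * h) n = fps_nth g k * fps_nth h (n - k)
        + (\<Sum>i\<in>{0..n} - {k}. fps_nth g i * fps_nth h (n - i))"
      unfolding fps_mult_nth by (rule sum.remove) (auto simp: n_def)
    ultimately have "v (fps_nth (g * h) n) = m * m' / r ^ n"
      using v_add_eq by simp
    then show ?thesis
      using r by (simp add: n_def)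
  qed
  ultimately show ?thesis
    unfolding dominant_def using A(1) B(1) by simp
qed

lemma mu_entire_mult:
  assumes "entire v g" "entire v h" "0 < r"
  shows "mu_entire v r (g * h) = mu_entire v r g * mu_entire v r h"
proof (cases "g = 0 \<or> h = 0")
  case False
  then obtain k m l m' where "dominant r g k m" "dominant r h l m'"
    using ex_dominant assms by meson
  then show ?thesis
    using dominant_mult[OF _ _ assms(3)] dominant_mu_entire by metis
qed auto

text \<open>On the circle \<open>v z = r\<close> both terms are maximal; taking the last index
  counts this zero as well, as the closed disc requires.\<close>

lemma dominant_linear_inside:
  assumes "v z \<le> r" "0 < r"
  shows "dominant r (fps_X - fps_const z) 1 r"
  using assms unfolding dominant_def
  by (auto simp: fps_X_def gr0_conv_Suc split: if_splits)

lemma dominant_linear_outside: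
  assumes "v z > r" "0 < r"
  shows "dominant r (fps_X - fps_const z) 0 (v z)"
proof -
  have "0 < v z"
    using assms by linarith
  then show ?thesis
    using assms unfolding dominant_def by (auto simp: fps_X_def gr0_conv_Suc)
qed

end

section \<open>Taylor shifts\<close>

context nonarch
begin

text \<open>The series of \<open>g\<close> in the local coordinate at \<open>z\<close>. Its
  subdegree is the multiplicity of \<open>z\<close> as a zero, and its constant coefficient is the
  value at \<open>z\<close>.\<close>

definition shift :: "'k \<Rightarrow> 'k fps \<Rightarrow> 'k fps" where
  "shift z g = Abs_fps (taylor_coeff v g z)"

text \<open>The binomial coefficient has absolute value at most 1, and
  \<open>v z ^ (n - k) * r ^ k \<le> r ^ n\<close>. Recentring inside the disc therefore does not
  increase the Gauss norm.\<close>

lemma taylor_term_le: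
  assumes "v z \<le> r" "0 < r"
  shows "v (of_nat (n choose k) * fps_nth g n * z ^ (n - k)) * r ^ k \<le> v (fps_nth g n) * r ^ n"
proof (cases "k \<le> n")
  case True
  have "v (of_nat (n choose k)) * v (fps_nth g n) * v z ^ (n - k) * r ^ k
      \<le> 1 * v (fps_nth g n) * r ^ (n - k) * r ^ k"
    using assms by (intro mult_mono power_mono v_of_nat_le mult_nonneg_nonneg) auto
  also have "\<dots> = v (fps_nth g n) * r ^ n"
    using True by (simp add: mult.assoc flip: power_add)
  finally show ?thesis
    by (simp add: v_mult v_power)
qed (use assms in \<open>simp add: binomial_eq_0\<close>)

lemma taylor_terms_null:
  assumes "entire v g"
  shows "(\<lambda>n. v (of_nat (n choose k) * fps_nth g n * z ^ (n - k))) \<longlonglongrightarrow> 0"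
proof (rule null_squeeze)
  define r where "r = max 1 (v z)"
  have r: "v z \<le> r" "0 < r" "1 \<le> r"
    by (auto simp: r_def)
  show "(\<lambda>n. v (fps_nth g n) * r ^ n) \<longlonglongrightarrow> 0"
    using assms r(2) by (rule entire_tendsto)
  fix n
  have "v (of_nat (n choose k) * fps_nth g n * z ^ (n - k)) * 1
      \<le> v (of_nat (n choose k) * fps_nth g n * z ^ (n - k)) * r ^ k"
    using r by (intro mult_left_mono one_le_power) auto
  then show "v (of_nat (n choose k) * fps_nth g n * z ^ (n - k)) \<le> v (fps_nth g n) * r ^ n"
    using taylor_term_le[OF r(1,2), of n k g] by linarith
qed simp

lemma shift_nth: "fps_nth (shift z g) k = vsum v (\<lambda>n. of_nat (n choose k) * fps_nth g n * z ^ (n - k))"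
  by (simp add: shift_def taylor_coeff_def)

lemma shift_nth_le:
  assumes "entire v g" "v z \<le> r" "0 < r"
  shows "v (fps_nth (shift z g) k) * r ^ k \<le> mu_entire v r g"
proof -
  have "v (fps_nth (shift z g) k) \<le> mu_entire v r g / r ^ k"
    unfolding shift_nth
  proof (rule v_vsum_le[OF taylor_terms_null[OF assms(1)]])
    fix n
    show "v (of_nat (n choose k) * fps_nth g n * z ^ (n - k)) \<le> mu_entire v r g / r ^ k"
      using order_trans[OF taylor_term_le[OF assms(2,3)] mu_entire_ge[OF assms(1,3)]] assms(3)
      by (simp add: field_simps)
  qed
  then show ?thesis
    using assms(3) by (simp add: field_simps)
qed

lemma entire_shift [simp, intro]:
  assumes "entire v g"
  shows "entire v (shift z g)"
proof (rule entireI)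
  fix r :: real assume r: "0 < r"
  define R where "R = max r (v z)"
  have R: "v z \<le> R" "0 < R" "r \<le> R"
    using r by (auto simp: R_def)
  have "v (fps_nth (shift z g) k) * r ^ k \<le> mu_entire v R g" for k
  proof -
    have "v (fps_nth (shift z g) k) * r ^ k \<le> v (fps_nth (shift z g) k) * R ^ k"
      using r R by (intro mult_left_mono power_mono) auto
    then show ?thesis
      using shift_nth_le[OF assms R(1,2), of k] by linarith
  qed
  then show "\<exists>B. \<forall>k. v (fps_nth (shift z g) k) * r ^ k \<le> B"
    by blast
qed

lemma mu_entire_shift_le:
  assumes "entire v g" "v z \<le> r" "0 < r"
  shows "mu_entire v r (shift z g) \<le> mu_entire v r g"
  by (rule mu_entire_le) (rule shift_nth_le[OF assms])

lemma shift_add: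
  assumes "entire v g" "entire v h"
  shows "shift z (g + h) = shift z g + shift z h"
proof (rule fps_ext)
  fix k
  show "fps_nth (shift z (g + h)) k = fps_nth (shift z g + shift z h) k"
    unfolding shift_nth fps_add_nth vsum_add[OF taylor_terms_null[OF assms(1)] taylor_terms_null[OF assms(2)], symmetric]
    by (simp add: distrib_left distrib_right)
qed

lemma linear_power_nth:
  "fps_nth ((fps_X + fps_const z) ^ n) k = of_nat (n choose k) * (z::'k) ^ (n - k)"
proof -
  have "fps_nth ((fps_X + fps_const z) ^ n) k = coeff ([:z, 1:] ^ n) k"
    unfolding fps_of_poly_linear[symmetric] fps_of_poly_power[symmetric] by simp
  also have "\<dots> = of_nat (n choose k) * z ^ (n - k)"
  proof (cases "k \<le> n")
    case True
    then show ?thesis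
      by (simp add: coeff_linear_poly_power)
  next
    case False
    then have "degree ([:z, 1:] ^ n) < k"
      by (simp add: degree_power_eq)
    then show ?thesis
      using False by (simp add: coeff_eq_0 binomial_eq_0)
  qed
  finally show ?thesis .
qed

lemma shift_monom:
  "shift z (fps_const c * fps_X ^ n) = fps_const c * (fps_X + fps_const z) ^ n"
proof (rule fps_ext)
  fix k
  have "fps_nth (shift z (fps_const c * fps_X ^ n)) k =
      (\<Sum>i<Suc n. of_nat (i choose k) * fps_nth (fps_const c * fps_X ^ n) i * z ^ (i - k))"
    unfolding shift_nth by (rule vsum_finite) (simp add: fps_X_power_nth)
  also have "\<dots> = of_nat (n choose k) * c * z ^ (n - k)"
    by (simp add: fps_X_power_nth)
  finally show "fps_nth (shift z (fps_const c * fps_X ^ n)) k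
      = fps_nth (fps_const c * (fps_X + fps_const z) ^ n) k"
    by (simp add: linear_power_nth)
qed

lemma fps_cutoff_Suc: "fps_cutoff (Suc N) g = fps_cutoff N g + fps_const (fps_nth g N) * fps_X ^ N"
  by (rule fps_ext) (auto simp: fps_X_power_nth less_Suc_eq)

lemma entire_cutoff [simp]: "entire v (fps_cutoff N g)"
  by (rule entire_finite[of N]) simp

text \<open>Polynomials are dense for the Gauss norm, so a bounded additive map is determined by its
  values on monomials.\<close>
lemma bounded_additive_eq_0:
  assumes add: "\<And>g h. entire v g \<Longrightarrow> entire v h \<Longrightarrow> \<Phi> (g + h) = \<Phi> g + \<Phi> h"
    and monom: "\<And>c n. \<Phi> (fps_const c * fps_X ^ n) = 0"
    and R: "0 < R"
    and bound: "\<And>g. entire v g \<Longrightarrow> v (\<Phi> g) \<le> C * mu_entire v R g"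
    and g: "entire v g"
  shows "\<Phi> g = 0"
proof -
  have cutoff: "\<Phi> (fps_cutoff N g) = 0" for N
  proof (induction N)
    case 0
    then show ?case
      using monom[of 0 0] by (simp add: fps_cutoff_def fps_zero_def)
  next
    case (Suc N)
    then show ?case
      unfolding fps_cutoff_Suc by (subst add) (auto simp: monom)
  qed
  have "v (\<Phi> g) \<le> \<bar>C\<bar> * e" if e: "0 < e" for e
  proof -
    obtain N where N: "\<And>n. n \<ge> N \<Longrightarrow> v (fps_nth g n) * R ^ n < e"
      using order_tendstoD(2)[OF entire_tendsto[OF g R] e] by (auto simp: eventually_sequentially)
    define t where "t = g - fps_cutoff N g"
    have t: "entire v t"
      unfolding t_def using g by auto
    have "mu_entire v R t \<le> e"
      by (rule mu_entire_le) (use e N in \<open>auto simp: t_def less_imp_le\<close>)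
    then have "C * mu_entire v R t \<le> \<bar>C\<bar> * e"
      using mu_entire_nonneg[OF t R] by (intro mult_mono) auto
    moreover have "\<Phi> g = \<Phi> t"
      using add[OF t entire_cutoff, of N g] cutoff by (simp add: t_def)
    ultimately show ?thesis
      using bound[OF t] by simp
  qed
  \<comment> \<open>Dividing by \<open>\<bar>C\<bar> + 1\<close> also covers
    \<open>C = 0\<close>.\<close>
  then have *: "v (\<Phi> g) \<le> \<bar>C\<bar> * (e / (\<bar>C\<bar> + 1))" if "0 < e" for e
    using that by (metis abs_ge_zero add_nonneg_pos divide_pos_pos zero_less_one)
  have "v (\<Phi> g) \<le> 0 + e" if "0 < e" for e
  proof -
    have "\<bar>C\<bar> * (e / (\<bar>C\<bar> + 1)) \<le> e"
      using that by (simp add: field_simps)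
    then show ?thesis
      using *[OF that] by linarith
  qed
  then have "v (\<Phi> g) \<le> 0"
    by (rule field_le_epsilon)
  then have "v (\<Phi> g) = 0"
    using v_nonneg[of "\<Phi> g"] by linarith
  then show ?thesis
    by simp
qed

text \<open>Applied to each coefficient of the difference separately. The constant may depend on
  \<open>k\<close>, so \<open>R ^ k\<close> is absorbed into it.\<close>

lemma bounded_additive_eq:
  assumes add: "\<And>g h. entire v g \<Longrightarrow> entire v h \<Longrightarrow> \<Phi> (g + h) = \<Phi> g + \<Phi> h"
    and add': "\<And>g h. entire v g \<Longrightarrow> entire v h \<Longrightarrow> \<Psi> (g + h) = \<Psi> g + \<Psi> h"
    and monom: "\<And>c n. \<Phi> (fps_const c * fps_X ^ n) = \<Psi> (fps_const c * fps_X ^ n)"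
    and R: "0 < R"
    and bound: "\<And>g k. entire v g \<Longrightarrow> v (fps_nth (\<Phi> g) k) * R ^ k \<le> C * mu_entire v R g"
    and bound': "\<And>g k. entire v g \<Longrightarrow> v (fps_nth (\<Psi> g) k) * R ^ k \<le> C * mu_entire v R g"
    and g: "entire v g"
  shows "\<Phi> g = \<Psi> g"
proof (rule fps_ext)
  fix k
  have "fps_nth (\<Phi> g) k - fps_nth (\<Psi> g) k = 0"
  proof (rule bounded_additive_eq_0[of "\<lambda>g. fps_nth (\<Phi> g) k - fps_nth (\<Psi> g) k" R "C / R ^ k"])
    fix g assume g: "entire v g"
    have "v (fps_nth (\<Phi> g) k) \<le> C / R ^ k * mu_entire v R g"
      "v (fps_nth (\<Psi> g) k) \<le> C / R ^ k * mu_entire v R g"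
      using bound[OF g, of k] bound'[OF g, of k] R by (simp_all add: field_simps)
    then show "v (fps_nth (\<Phi> g) k - fps_nth (\<Psi> g) k) \<le> C / R ^ k * mu_entire v R g"
      using v_diff_le_max[of "fps_nth (\<Phi> g) k" "fps_nth (\<Psi> g) k"] by simp
  qed (use add add' monom R g in simp_all)
  then show "fps_nth (\<Phi> g) k = fps_nth (\<Psi> g) k"
    by simp
qed

text \<open>The density argument is used twice: with a monomial as left factor it extends the
  identity to every right factor \<open>h\<close>, and then it extends the left factor. On two
  monomials the identity is the power law for \<open>fps_X + fps_const z\<close>.\<close>

lemma shift_mult:
  assumes "entire v g" "entire v h"
  shows "shift z (g * h) = shift z g * shift z h"
proof -
  define R where "R = max 1 (v z)"
  have R: "v z \<le> R" "0 < R"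
    by (auto simp: R_def)
  have bd1: "v (fps_nth (shift z (g * h)) k) * R ^ k \<le> mu_entire v R g * mu_entire v R h"
    if "entire v g" "entire v h" for g h k
    using shift_nth_le[OF entire_mult[OF that] R] mu_entire_mult[OF that R(2)] by simp
  have bd2: "v (fps_nth (shift z g * shift z h) k) * R ^ k \<le> mu_entire v R g * mu_entire v R h"
    if "entire v g" "entire v h" for g h k
    using that R by (intro fps_mult_terms_le shift_nth_le mu_entire_nonneg)
  have monom: "shift z (fps_const c * fps_X ^ n * h) = shift z (fps_const c * fps_X ^ n) * shift z h"
    if h: "entire v h" for h c n
  proof (rule bounded_additive_eq[of "\<lambda>h. shift z (fps_const c * fps_X ^ n * h)"
        "\<lambda>h. shift z (fps_const c * fps_X ^ n) * shift z h" R "mu_entire v R (fps_const c * fps_X ^ n)"])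
    fix d m
    have "fps_const c * fps_X ^ n * (fps_const d * fps_X ^ m) = fps_const (c * d) * fps_X ^ (n + m)"
      by (simp add: power_add mult_ac flip: fps_const_mult)
    then show "shift z (fps_const c * fps_X ^ n * (fps_const d * fps_X ^ m)) =
        shift z (fps_const c * fps_X ^ n) * shift z (fps_const d * fps_X ^ m)"
      by (simp only: shift_monom) (simp add: power_add mult_ac flip: fps_const_mult)
  qed (use h R(2) bd1 bd2 in \<open>auto simp: shift_add distrib_left\<close>)
  show ?thesis
  proof (rule bounded_additive_eq[of "\<lambda>g. shift z (g * h)"
        "\<lambda>g. shift z g * shift z h" R "mu_entire v R h"])
    fix g k assume "entire v g"
    then show "v (fps_nth (shift z (g * h)) k) * R ^ k \<le> mu_entire v R h * mu_entire v R g"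
      "v (fps_nth (shift z g * shift z h) k) * R ^ k \<le> mu_entire v R h * mu_entire v R g"
      using bd1[of g h k] bd2[of g h k] assms(2) by (simp_all add: mult.commute)
  qed (use assms monom R(2) in \<open>simp_all add: shift_add distrib_right\<close>)
qed

lemma shift_const [simp]: "shift z (fps_const c) = fps_const c"
  using shift_monom[of z c 0] by simp

lemma shift_1 [simp]: "shift z 1 = 1"
  using shift_const[of z 1] by simp

lemma shift_0 [simp]: "shift z 0 = 0"
  using shift_const[of z 0] by simp

lemma shift_X: "shift z fps_X = fps_X + fps_const z"
  using shift_monom[of z 1 1] by simp

lemma shift_power: "entire v g \<Longrightarrow> shift z (g ^ n) = shift z g ^ n"
  by (induction n) (auto simp: shift_mult)

lemma shift_minus:
  assumes "entire v g"
  shows "shift z (- g) = - shift z g"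
  using shift_add[OF assms entire_minus[OF assms], of z] by (simp add: add_eq_0_iff)

lemma shift_diff:
  assumes "entire v g" "entire v h"
  shows "shift z (g - h) = shift z g - shift z h"
  using shift_add[OF assms(1) entire_minus[OF assms(2)], of z] shift_minus[OF assms(2)] by simp

text \<open>On monomials the two translations cancel. The resulting injectivity keeps shifted
  denominators non-zero.\<close>

lemma shift_shift_minus:
  assumes "entire v g"
  shows "shift (- z) (shift z g) = g"
proof -
  define R where "R = max 1 (v z)"
  have R: "v z \<le> R" "v (- z) \<le> R" "0 < R"
    by (auto simp: R_def)
  show ?thesis
  proof (rule bounded_additive_eq[of "\<lambda>g. shift (- z) (shift z g)" "\<lambda>g. g" R 1])
    fix c n
    show "shift (- z) (shift z (fps_const c * fps_X ^ n)) = fps_const c * fps_X ^ n"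
    proof -
      have "shift (- z) (fps_X + fps_const z) = fps_X + (fps_const (- z) + fps_const z)"
        by (simp only: shift_add shift_X shift_const entire_X entire_const add.assoc)
      also have "\<dots> = fps_X"
        by simp
      finally show ?thesis
        by (simp only: shift_monom shift_mult shift_power shift_const entire_X entire_const
            entire_add entire_power)
    qed
  next
    fix g k assume g: "entire v g"
    show "v (fps_nth (shift (- z) (shift z g)) k) * R ^ k \<le> 1 * mu_entire v R g"
      using shift_nth_le[OF entire_shift[OF g] R(2,3), of z k] mu_entire_shift_le[OF g R(1,3)] by simp
  qed (use assms R mu_entire_ge in \<open>auto simp: shift_add entire_shift\<close>)
qed

lemma shift_eq_0_iff: "entire v g \<Longrightarrow> shift z g = 0 \<longleftrightarrow> g = 0"
  using shift_shift_minus[of g z] by auto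

text \<open>This is what lets pole orders of derivatives at an arbitrary point be computed by formal
  differentiation of the local expansion.\<close>

lemma shift_deriv:
  assumes "entire v g"
  shows "shift z (fps_deriv g) = fps_deriv (shift z g)"
proof -
  define R where "R = max 1 (v z)"
  have R: "v z \<le> R" "0 < R"
    by (auto simp: R_def)
  show ?thesis
  proof (rule bounded_additive_eq[of "\<lambda>g. shift z (fps_deriv g)" "\<lambda>g. fps_deriv (shift z g)" R "1 / R"])
    fix c n
    have "shift z (fps_deriv (fps_const c * fps_X ^ n)) =
        shift z (fps_const (of_nat n * c) * fps_X ^ (n - 1))"
      by (simp add: fps_deriv_power mult_ac fps_of_nat flip: fps_const_mult)
    also have "\<dots> = fps_deriv (fps_const c * (fps_X + fps_const z) ^ n)"
      unfolding shift_monom by (simp add: fps_deriv_power mult_ac fps_of_nat flip: fps_const_mult)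
    finally show "shift z (fps_deriv (fps_const c * fps_X ^ n)) = fps_deriv (shift z (fps_const c * fps_X ^ n))"
      by (simp add: shift_monom)
  next
    fix g k assume g: "entire v g"
    show "v (fps_nth (shift z (fps_deriv g)) k) * R ^ k \<le> 1 / R * mu_entire v R g"
      using shift_nth_le[OF entire_deriv[OF g] R, of k] mu_entire_le[OF mu_entire_deriv[OF g R(2)]] by simp
    show "v (fps_nth (fps_deriv (shift z g)) k) * R ^ k \<le> 1 / R * mu_entire v R g"
      using mu_entire_deriv[OF entire_shift[OF g] R(2), of z k]
        divide_right_mono[OF mu_entire_shift_le[OF g R], of R] R(2) by simp
  qed (use assms R in \<open>auto simp: shift_add entire_deriv\<close>)
qed

lemma shift_by_0: "entire v g \<Longrightarrow> shift 0 g = g"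
proof (rule fps_ext)
  fix k
  have "fps_nth (shift 0 g) k = (\<Sum>n<Suc k. of_nat (n choose k) * fps_nth g n * 0 ^ (n - k))"
    unfolding shift_nth by (rule vsum_finite) simp
  \<comment> \<open>Subtraction truncates, so \<open>0 ^ (n - k)\<close> is 1 for every
    \<open>n \<le> k\<close>; the binomial coefficient removes those with
    \<open>n < k\<close>.\<close>
  also have "\<dots> = fps_nth g k"
    by (simp add: sum.neutral binomial_eq_0)
  finally show "fps_nth (shift 0 g) k = fps_nth g k" .
qed

lemma zero_order_eq_subdegree:
  assumes "entire v g" "g \<noteq> 0"
  shows "zero_order v g z = subdegree (shift z g)"
proof -
  have "shift z g \<noteq> 0"
    using assms by (simp add: shift_eq_0_iff)
  then show ?thesis
    unfolding zero_order_def subdegree_def by (simp add: shift_def)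
qed

text \<open>Move the zero to the origin, divide by \<open>fps_X\<close>, and move back. Division by
  \<open>fps_X\<close> changes a bound on the terms at radius \<open>r\<close> only by the factor
  \<open>1 / r\<close>, so the quotient is entire.\<close>

lemma factor_zero:
  assumes "entire v g" "fps_nth (shift z g) 0 = 0"
  obtains u where "entire v u" "g = (fps_X - fps_const z) * u"
proof
  define w where "w = fps_shift 1 (shift z g)"
  have sg: "shift z g = fps_X * w"
    using assms(2) by (intro fps_ext) (simp add: w_def)
  have w: "entire v w"
  proof (rule entireI)
    fix r :: real assume r: "0 < r"
    obtain B where B: "\<And>n. v (fps_nth (shift z g) n) * r ^ n \<le> B"
      using entire_bounded[OF entire_shift[OF assms(1)] r] by blast
    have "v (fps_nth w n) * r ^ n \<le> B / r" for n
      using B[of "Suc n"] r by (simp add: w_def field_simps)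
    then show "\<exists>B. \<forall>n. v (fps_nth w n) * r ^ n \<le> B"
      by blast
  qed
  show "entire v (shift (- z) w)"
    using w by auto
  have "g = shift (- z) (fps_X * w)"
    using shift_shift_minus[OF assms(1), of z] sg by simp
  also have "\<dots> = (fps_X - fps_const z) * shift (- z) w"
    using w by (simp add: shift_mult shift_X flip: fps_const_neg)
  finally show "g = (fps_X - fps_const z) * shift (- z) w" .
qed

end

section \<open>Zeros in a closed disc\<close>

text \<open>The minimum is a witness. The purpose is to extract from a small product of distances to
  roots one root that is close.\<close>

lemma ex_power_le_prod_list:
  fixes xs :: "real list"
  assumes "xs \<noteq> []" "\<And>x. x \<in> set xs \<Longrightarrow> 0 \<le> x"
  shows "\<exists>x\<in>set xs. x ^ length xs \<le> prod_list xs"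
proof
  define y where "y = Min (set xs)"
  show y: "y \<in> set xs"
    unfolding y_def using assms(1) by (intro Min_in) auto
  have "y ^ length ys \<le> prod_list ys" if "set ys \<subseteq> set xs" for ys
    using that
  proof (induction ys)
    case (Cons a ys)
    have "y \<le> a"
      unfolding y_def using Cons.prems by (intro Min_le) auto
    then show ?case
      using Cons assms(2)[OF y] by (auto intro!: mult_mono)
  qed simp
  then show "y ^ length xs \<le> prod_list xs"
    by blast
qed

context nonarch
begin

abbreviation lin :: "'k \<Rightarrow> 'k fps" where
  "lin z \<equiv> fps_X - fps_const z"

abbreviation value_at :: "'k fps \<Rightarrow> 'k \<Rightarrow> 'k" where
  "value_at g z \<equiv> fps_nth (shift z g) 0"

lemma shift_lin: "shift z (lin a) = fps_X + fps_const (z - a)"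
  by (simp add: shift_diff shift_X flip: fps_const_sub)

lemma value_at_lin: "value_at (lin a) z = z - a"
  by (simp add: shift_lin)

lemma lin_neq_0 [simp]: "lin z \<noteq> 0"
proof
  assume "lin z = 0"
  then have "fps_nth (lin z) 1 = 0"
    by simp
  then show False
    by simp
qed

lemma value_at_mult: "entire v g \<Longrightarrow> entire v h \<Longrightarrow> value_at (g * h) z = value_at g z * value_at h z"
  by (simp add: shift_mult)

lemma value_at_cutoff: "value_at (fps_cutoff N g) z = (\<Sum>n<N. fps_nth g n * z ^ n)"
  unfolding shift_nth by (subst vsum_finite[of N]) auto

lemma v_value_at_le: "entire v g \<Longrightarrow> v z \<le> r \<Longrightarrow> 0 < r \<Longrightarrow> v (value_at g z) \<le> mu_entire v r g"
  using shift_nth_le[of g z r 0] by simp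

text \<open>If index 0 is the last maximal one, the constant term beats all others strictly, so the
  absolute value is constant on the closed disc; in particular there are no zeros.\<close>

lemma v_value_at_dominant_0:
  assumes u: "entire v u" "dominant r u 0 m" and z: "v z \<le> r" and r: "0 < r"
  shows "v (value_at u z) = m"
proof -
  define w where "w = u - fps_const (fps_nth u 0)"
  have w: "entire v w" and u_eq: "u = fps_const (fps_nth u 0) + w"
    using u by (auto simp: w_def)
  have m: "0 < m" "v (fps_nth u 0) = m"
    using u(2) by (auto simp: dominant_def)
  have "mu_entire v r w < m"
  proof (cases "w = 0")
    case False
    then obtain k m' where d: "dominant r w k m'"
      using ex_dominant[OF w _ r] by blast
    then have "fps_nth w k \<noteq> 0"
      by (auto simp: dominant_def)
    then have "k > 0" "fps_nth w k = fps_nth u k"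
      by (auto simp: w_def intro: gr0I)
    then have "m' < m"
      using d u(2) by (auto simp: dominant_def)
    then show ?thesis
      using dominant_mu_entire[OF d] by simp
  qed (use m in simp)
  then have "v (value_at w z) < v (fps_nth u 0)"
    using v_value_at_le[OF w z r] m by simp
  then have "v (fps_nth u 0 + value_at w z) = m"
    using v_add_eq m by simp
  moreover have "value_at u z = fps_nth u 0 + value_at w z"
    by (subst u_eq) (use w in \<open>simp add: shift_add\<close>)
  ultimately show ?thesis
    by simp
qed

text \<open>A converse to multiplicativity: \<open>q\<close> has some datum, and uniqueness of the
  datum of the product determines it.\<close>

lemma dominant_lin_multD:
  assumes "dominant r (lin z * q) k m" "entire v q" "0 < r"
  shows "if v z \<le> r then \<exists>k'. k = Suc k' \<and> dominant r q k' (m / r) else dominant r q k (m / v z)"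
proof -
  have "q \<noteq> 0"
    using assms(1) by (auto simp: dominant_def)
  then obtain k' m' where q: "dominant r q k' m'"
    using ex_dominant assms(2,3) by blast
  show ?thesis
  proof (cases "v z \<le> r")
    case True
    then have "k = 1 + k' \<and> m = r * m'"
      using dominant_unique[OF assms(1) dominant_mult[OF dominant_linear_inside q assms(3)]] assms(3) by simp
    then show ?thesis
      using True q assms(3) by simp
  next
    case False
    then have "k = 0 + k' \<and> m = v z * m'"
      using dominant_unique[OF assms(1) dominant_mult[OF dominant_linear_outside q assms(3)]] assms(3) by simp
    moreover have "z \<noteq> 0"
      using False assms(3) by auto
    ultimately show ?thesis
      using False q assms(3) by simp
  qed
qed

text \<open>The analogue of Weierstrass preparation on the closed disc of radius \<open>r\<close>.\<close>
definition disc_factors :: "real \<Rightarrow> 'k fps \<Rightarrow> 'k list \<Rightarrow> 'k fps \<Rightarrow> real \<Rightarrow> bool" where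
  "disc_factors r g zs u m \<longleftrightarrow> (\<forall>z\<in>set zs. v z \<le> r) \<and> g = prod_list (map lin zs) * u \<and> entire v u \<and>
     dominant r u 0 m"

lemma disc_factors_Nil: "entire v g \<Longrightarrow> dominant r g 0 m \<Longrightarrow> disc_factors r g [] g m"
  by (simp add: disc_factors_def)

lemma disc_factors_Cons:
  "v z \<le> r \<Longrightarrow> disc_factors r q zs u m \<Longrightarrow> disc_factors r (lin z * q) (z # zs) u m"
  by (simp add: disc_factors_def mult.assoc)

lemma entire_prod_lin [simp]: "entire v (prod_list (map lin zs))"
  by (induction zs) auto

lemma value_at_prod_lin: "value_at (prod_list (map lin zs)) a = prod_list (map (\<lambda>z. a - z) zs)"
  by (induction zs) (simp_all add: shift_mult shift_lin)

lemma v_value_at_disc_factors: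
  assumes "disc_factors r g zs u m" "v a \<le> r" "0 < r"
  shows "v (value_at g a) = prod_list (map (\<lambda>z. v (a - z)) zs) * m"
proof -
  have u: "g = prod_list (map lin zs) * u" "entire v u" "dominant r u 0 m"
    using assms(1) by (auto simp: disc_factors_def)
  have "v (prod_list (map (\<lambda>z. a - z) zs)) = prod_list (map (\<lambda>z. v (a - z)) zs)"
    by (induction zs) (simp_all add: v_mult)
  then show ?thesis
    using u v_value_at_dominant_0[OF u(2,3) assms(2,3)]
    by (simp add: value_at_mult v_mult value_at_prod_lin)
qed

end

locale nonarch_closed = nonarch v for v :: "'k::field_char_0 \<Rightarrow> real" +
  assumes closed: "alg_closed_field TYPE('k)"
begin

text \<open>Roots are split off one at a time. A root in the disc lowers the index by one and
  divides the norm by \<open>r\<close>; a root outside is absorbed into the zero-free factor. This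
  leaves \<open>m / r ^ k\<close> as the norm of that factor.\<close>

lemma poly_disc_factors:
  assumes "dominant r (fps_of_poly p) k m" "0 < r"
  shows "\<exists>zs u. length zs = k \<and> disc_factors r (fps_of_poly p) zs u (m / r ^ k)"
  using assms(1)
proof (induction "degree p" arbitrary: p k m rule: less_induct)
  case less
  show ?case
  proof (cases "degree p = 0")
    case True
    then obtain c where "p = [:c:]"
      using degree_eq_zeroE by blast
    then have "k = 0"
      using less.prems by (cases k) (auto simp: dominant_def)
    then show ?thesis
      using less.prems disc_factors_Nil[OF entire_of_poly] by (intro exI[of _ "[]"]) auto
  next
    case False
    then obtain z where "poly p z = 0"
      using closed unfolding alg_closed_field_def by (metis One_nat_def Suc_leI gr0I)
    then obtain q where pq: "p = [:- z, 1:] * q"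
      unfolding poly_eq_0_iff_dvd by (auto elim: dvdE)
    have "q \<noteq> 0"
      using False pq by auto
    then have deg: "degree q < degree p"
      unfolding pq by (subst degree_mult_eq) auto
    have fp: "fps_of_poly p = lin z * fps_of_poly q"
      unfolding pq fps_of_poly_mult fps_of_poly_linear by (simp flip: fps_const_neg)
    note D = dominant_lin_multD[OF less.prems[unfolded fp] entire_of_poly assms(2)]
    show ?thesis
    proof (cases "v z \<le> r")
      case True
      then obtain k' where k': "k = Suc k'" "dominant r (fps_of_poly q) k' (m / r)"
        using D by auto
      then obtain zs u where "length zs = k'" "disc_factors r (fps_of_poly q) zs u (m / r / r ^ k')"
        using less.hyps[OF deg] by blast
      then show ?thesis
        using True k' disc_factors_Cons unfolding fp by (intro exI[of _ "z # zs"] exI[of _ u]) auto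
    next
      case False
      then have "dominant r (fps_of_poly q) k (m / v z)"
        using D by auto
      then obtain zs u where zs: "length zs = k" "disc_factors r (fps_of_poly q) zs u (m / v z / r ^ k)"
        using less.hyps[OF deg] by blast
      have "z \<noteq> 0"
        using False assms(2) by auto
      moreover have "dominant r (lin z * u) (0 + 0) (v z * (m / v z / r ^ k))"
        using zs False assms(2) by (intro dominant_mult dominant_linear_outside) (auto simp: disc_factors_def)
      ultimately have "disc_factors r (fps_of_poly p) zs (lin z * u) (m / r ^ k)"
        using zs unfolding fp by (auto simp: disc_factors_def mult_ac)
      then show ?thesis
        using zs by blast
    qed
  qed
qed

lemma cutoff_disc_factors:
  assumes "dominant r (fps_cutoff N g) k m" "0 < r"
  shows "\<exists>zs u. length zs = k \<and> disc_factors r (fps_cutoff N g) zs u (m / r ^ k)"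
proof -
  have "fps_cutoff N g = fps_of_poly (\<Sum>n<N. monom (fps_nth g n) n)"
    by (rule fps_ext) (simp add: coeff_sum)
  then show ?thesis
    using poly_disc_factors[of r "\<Sum>n<N. monom (fps_nth g n) n" k m] assms by (simp only: )
qed

text \<open>Roots of successive truncations can be chosen to form a Cauchy sequence, whose limit is a zero.\<close>
lemma ex_zero_in_disc:
  assumes g: "entire v g" and d: "dominant r g k m" and k: "k > 0" and r: "0 < r"
  shows "\<exists>z. v z \<le> r \<and> value_at g z = 0"
proof -
  \<comment> \<open>Every truncation retains index \<open>k\<close>, so all \<open>P N\<close> share
    the datum \<open>k\<close>, \<open>m\<close> and have exactly \<open>k\<close> roots in the
    disc.\<close>
  define P where "P = (\<lambda>N. fps_cutoff (k + 1 + N) g)"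
  have m: "0 < m"
    using d by (simp add: dominant_def)
  have dP: "dominant r (P N) k m" for N
    using d m by (auto simp: dominant_def P_def)
  define Z where "Z = (\<lambda>N. {z. v z \<le> r \<and> value_at (P N) z = 0})"
  \<comment> \<open>The size of the next term on the disc, divided by the norm
    \<open>m / r ^ k\<close> of the zero-free factor.\<close>
  define e where "e = (\<lambda>N. v (fps_nth g (k + 1 + N)) * r ^ (k + 1 + N) * (r ^ k / m))"
  have root: "z \<in> Z N" if "disc_factors r (P N) zs u m'" "z \<in> set zs" for z N zs u m'
  proof -
    have vz: "v z \<le> r"
      using that by (auto simp: disc_factors_def)
    have "v (value_at (P N) z) = 0"
      unfolding v_value_at_disc_factors[OF that(1) vz r] using that(2)
      by (auto simp: prod_list_zero_iff)
    then show ?thesis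
      using vz by (simp add: Z_def)
  qed
  have "\<exists>\<alpha>. \<forall>N. \<alpha> N \<in> Z N \<and> v (\<alpha> N - \<alpha> (Suc N)) ^ k \<le> e N"
  proof (rule dependent_nat_choice)
    obtain zs u where zs: "length zs = k" "disc_factors r (P 0) zs u (m / r ^ k)"
      using cutoff_disc_factors[OF _ r] dP[of 0] unfolding P_def by blast
    have "hd zs \<in> set zs"
      using zs(1) k by (intro hd_in_set) auto
    then show "\<exists>z. z \<in> Z 0"
      using root[OF zs(2)] by blast
  next
    fix a N assume a: "a \<in> Z N"
    define K where "K = k + 1 + N"
    obtain zs u where zs: "length zs = k" "disc_factors r (P (Suc N)) zs u (m / r ^ k)"
      using cutoff_disc_factors[OF _ r] dP[of "Suc N"] unfolding P_def by blast
    have va: "v a \<le> r" "value_at (P N) a = 0"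
      using a by (auto simp: Z_def)
    \<comment> \<open>Since \<open>a\<close> is a root of \<open>P N\<close>, only the newly added
      term survives at \<open>a\<close>. It bounds the product of the distances from
      \<open>a\<close> to the \<open>k\<close> roots of the next truncation.\<close>
    have "value_at (P (Suc N)) a = fps_nth g K * a ^ K"
      using va(2) by (simp add: P_def K_def value_at_cutoff)
    then have "v (value_at (P (Suc N)) a) \<le> v (fps_nth g K) * r ^ K"
      using va(1) by (auto simp: v_mult v_power intro!: mult_left_mono power_mono)
    then have "prod_list (map (\<lambda>z. v (a - z)) zs) * (m / r ^ k) \<le> v (fps_nth g K) * r ^ K"
      using v_value_at_disc_factors[OF zs(2) va(1) r] by simp
    then have le: "prod_list (map (\<lambda>z. v (a - z)) zs) \<le> e N"
      using r m by (simp add: e_def K_def field_simps)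
    have "\<exists>x\<in>set (map (\<lambda>z. v (a - z)) zs). x ^ length (map (\<lambda>z. v (a - z)) zs) \<le> prod_list (map (\<lambda>z. v (a - z)) zs)"
      by (rule ex_power_le_prod_list) (use zs k in auto)
    then obtain b where "b \<in> set zs" "v (a - b) ^ k \<le> prod_list (map (\<lambda>z. v (a - z)) zs)"
      using zs(1) by auto
    then show "\<exists>b. b \<in> Z (Suc N) \<and> v (a - b) ^ k \<le> e N"
      using root[OF zs(2)] le by force
  qed
  then obtain \<alpha> where \<alpha>: "\<And>N. \<alpha> N \<in> Z N" "\<And>N. v (\<alpha> N - \<alpha> (Suc N)) ^ k \<le> e N"
    by blast
  have "(\<lambda>n. v (fps_nth g (n + (k + 1))) * r ^ (n + (k + 1)) * (r ^ k / m)) \<longlonglongrightarrow> 0"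
    by (intro tendsto_mult_left_zero LIMSEQ_ignore_initial_segment entire_tendsto g r)
  then have "e \<longlonglongrightarrow> 0"
    by (simp add: e_def add.commute add.left_commute)
  then have "(\<lambda>N. v (\<alpha> N - \<alpha> (Suc N)) ^ k) \<longlonglongrightarrow> 0"
    by (rule null_squeeze) (use \<alpha>(2) in auto)
  then have "(\<lambda>N. root k (v (\<alpha> N - \<alpha> (Suc N)) ^ k)) \<longlonglongrightarrow> root k 0"
    by (rule tendsto_real_root)
  then have "(\<lambda>N. v (\<alpha> (Suc N) - \<alpha> N)) \<longlonglongrightarrow> 0"
    using k by (simp add: real_root_power_cancel v_diff_commute)
  then obtain L where L: "vlim v \<alpha> L"
    using vlim_convergent by blast
  have vL: "v L \<le> r"
    by (rule vlim_v_le[OF L]) (use \<alpha>(1) in \<open>auto simp: Z_def\<close>)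
  have "vlim v (\<lambda>N. \<Sum>n<N. fps_nth g n * L ^ n) (value_at g L)"
    using vsum_vlim[OF taylor_terms_null[OF g, of 0 L]] by (simp add: shift_nth)
  then have "(\<lambda>N. v ((\<Sum>n<N + (k + 1). fps_nth g n * L ^ n) - value_at g L)) \<longlonglongrightarrow> 0"
    unfolding vlim_def by (rule LIMSEQ_ignore_initial_segment)
  then have lim1: "vlim v (\<lambda>N. value_at (P N) L) (value_at g L)"
    unfolding vlim_def P_def value_at_cutoff by (simp only: add.commute)
  \<comment> \<open>Splitting the root \<open>\<alpha> N\<close> off \<open>P N\<close> leaves a
    cofactor of norm \<open>m / r\<close>, whatever \<open>N\<close> is, so the value at
    \<open>L\<close> is controlled by the distance from \<open>L\<close> to that root.\<close>
  have lim2: "vlim v (\<lambda>N. value_at (P N) L) 0"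
  proof (rule vlim_squeeze)
    fix N
    have aN: "v (\<alpha> N) \<le> r" "value_at (P N) (\<alpha> N) = 0"
      using \<alpha>(1)[of N] by (auto simp: Z_def)
    obtain w where w: "entire v w" "P N = lin (\<alpha> N) * w"
      using factor_zero[OF _ aN(2)] unfolding P_def by (metis entire_cutoff)
    have "dominant r (lin (\<alpha> N) * w) k m"
      using dP[of N] w(2) by simp
    then obtain k' where "dominant r w k' (m / r)"
      using dominant_lin_multD[OF _ w(1) r] aN(1) by force
    then have "v (value_at w L) \<le> m / r"
      using v_value_at_le[OF w(1) vL r] dominant_mu_entire by metis
    moreover have "value_at (P N) L = (L - \<alpha> N) * value_at w L"
      using w by (simp add: value_at_mult value_at_lin)
    ultimately show "v (value_at (P N) L - 0) \<le> v (\<alpha> N - L) * (m / r)"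
      using mult_left_mono[OF _ v_nonneg] by (simp only: v_mult v_diff_commute[of L] diff_0_right)
  next
    show "(\<lambda>N. v (\<alpha> N - L) * (m / r)) \<longlonglongrightarrow> 0"
      using L unfolding vlim_def by (rule tendsto_mult_left_zero)
  qed
  show ?thesis
    using vL vlim_unique[OF lim1 lim2] by blast
qed

text \<open>Each zero found lowers the dominant index by one, so the search stops after
  \<open>k\<close> steps with a cofactor of index 0.\<close>

lemma entire_disc_factors:
  assumes "entire v g" "dominant r g k m" "0 < r"
  shows "\<exists>zs u. length zs = k \<and> disc_factors r g zs u (m / r ^ k)"
  using assms(1,2)
proof (induction k arbitrary: g m)
  case 0
  then show ?case
    using disc_factors_Nil by (intro exI[of _ "[]"]) auto
next
  case (Suc k)
  obtain z where z: "v z \<le> r" "value_at g z = 0"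
    using ex_zero_in_disc[OF Suc.prems _ assms(3)] by blast
  obtain w where w: "entire v w" "g = lin z * w"
    using factor_zero[OF Suc.prems(1) z(2)] by blast
  have "dominant r w k (m / r)"
    using dominant_lin_multD[OF Suc.prems(2)[unfolded w(2)] w(1) assms(3)] z(1) by auto
  then obtain zs u where "length zs = k" "disc_factors r w zs u (m / r / r ^ k)"
    using Suc.IH[OF w(1)] by blast
  then show ?case
    using disc_factors_Cons[OF z(1)] unfolding w(2) by (intro exI[of _ "z # zs"] exI[of _ u]) auto
qed

end

section \<open>Jensen's formula\<close>

lemma sum_list_eq_sum_count:
  fixes f :: "'a \<Rightarrow> real"
  assumes "finite A" "set xs \<subseteq> A"
  shows "sum_list (map f xs) = (\<Sum>x\<in>A. real (count_list xs x) * f x)"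
  using assms(2)
proof (induction xs)
  case (Cons a xs)
  have "(\<Sum>x\<in>A. real (count_list (a # xs) x) * f x)
      = (\<Sum>x\<in>A. (if a = x then f x else 0) + real (count_list xs x) * f x)"
    by (intro sum.cong) (auto simp: distrib_right)
  also have "\<dots> = f a + (\<Sum>x\<in>A. real (count_list xs x) * f x)"
    using Cons.prems assms(1) by (simp add: sum.distrib sum.delta)
  finally show ?case
    using Cons by simp
qed simp

text \<open>The contribution to the counting integral of one simple pole of absolute value
  \<open>s\<close>, which is counted only from radius \<open>s\<close> on.\<close>

lemma has_integral_inverse_above:
  fixes s r :: real
  assumes "0 < s" "s \<le> r"
  shows "((\<lambda>t. if s \<le> t then 1 / t else 0) has_integral (ln r - ln s)) {0..r}"
proof -
  have "((\<lambda>t. 1 / t) has_integral (ln r - ln s)) {s..r}"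
    using assms by (intro fundamental_theorem_of_calculus)
      (auto intro!: derivative_eq_intros simp flip: has_real_derivative_iff_has_vector_derivative)
  then have "((\<lambda>t. if t \<in> {s..r} then 1 / t else 0) has_integral (ln r - ln s)) {0..r}"
    using assms by (subst has_integral_restrict) auto
  then show ?thesis
    by (rule has_integral_eq[rotated]) auto
qed

context nonarch
begin

text \<open>What one simple pole at \<open>z\<close> in the disc contributes to
  \<open>N_count\<close>: the integral gives \<open>ln (r / v z)\<close> for
  \<open>z \<noteq> 0\<close>, and the separate term for the origin gives
  \<open>ln r\<close>.\<close>

definition weight :: "real \<Rightarrow> 'k \<Rightarrow> real" where
  "weight r z = ln r - (if z = 0 then 0 else ln (v z))"

lemma weight_nonneg: "v z \<le> r \<Longrightarrow> 1 \<le> r \<Longrightarrow> 0 \<le> weight r z"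
  by (auto simp: weight_def)

text \<open>The set \<open>A\<close> may exceed the set of poles, since extra points have
  multiplicity 0. Counting functions of several functions can then be compared over one common
  set.\<close>

lemma N_count_eq_sum:
  assumes "0 < r" and "finite A" and "\<And>z. z \<in> A \<Longrightarrow> v z \<le> r"
    and "\<And>z. v z \<le> r \<Longrightarrow> pole_mult v f z \<noteq> 0 \<Longrightarrow> z \<in> A"
  shows "N_count v r f = (\<Sum>z\<in>A. real (pole_mult v f z) * weight r z)"
proof -
  define p where "p = (\<lambda>z. real (pole_mult v f z))"
  have n: "n_poles v t f = (\<Sum>z\<in>A. if v z \<le> t then p z else 0)" if "t \<le> r" for t
  proof -
    have "n_poles v t f = (\<Sum>z\<in>{z. v z \<le> t \<and> pole_mult v f z \<noteq> 0}. p z)"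
      by (simp add: n_poles_def p_def)
    also have "\<dots> = (\<Sum>z\<in>{z \<in> A. v z \<le> t}. p z)"
      using that assms by (intro sum.mono_neutral_left) (auto simp: p_def)
    also have "\<dots> = (\<Sum>z\<in>A. if v z \<le> t then p z else 0)"
      using assms(2) by (rule sum.inter_filter)
    finally show ?thesis .
  qed
  have n0: "n_poles v 0 f = (\<Sum>z\<in>A. if z = 0 then p z else 0)"
    unfolding n[OF less_imp_le[OF assms(1)]]
    by (intro sum.cong refl) (metis order.antisym v_0 v_eq_0_iff v_nonneg order.refl)
  have "((\<lambda>t. \<Sum>z\<in>A. if z = 0 then 0 else p z * (if v z \<le> t then 1 / t else 0)) has_integral
      (\<Sum>z\<in>A. if z = 0 then 0 else p z * (ln r - ln (v z)))) {0..r}"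
  proof (rule has_integral_sum[OF assms(2)])
    fix z assume "z \<in> A"
    show "((\<lambda>t. if z = 0 then 0 else p z * (if v z \<le> t then 1 / t else 0)) has_integral
        (if z = 0 then 0 else p z * (ln r - ln (v z)))) {0..r}"
    proof (cases "z = 0")
      case False
      then have "((\<lambda>t. p z * (if v z \<le> t then 1 / t else 0)) has_integral p z * (ln r - ln (v z))) {0..r}"
        using assms(3)[OF \<open>z \<in> A\<close>] by (intro has_integral_mult_right has_integral_inverse_above) auto
      then show ?thesis
        using False by simp
    qed simp
  qed
  then have "((\<lambda>t. (n_poles v t f - n_poles v 0 f) / t) has_integral
      (\<Sum>z\<in>A. if z = 0 then 0 else p z * (ln r - ln (v z)))) {0..r}"
  proof (rule has_integral_eq[rotated])
    fix t assume t: "t \<in> {0..r}"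
    have "n_poles v t f - n_poles v 0 f = (\<Sum>z\<in>A. if z \<noteq> 0 \<and> v z \<le> t then p z else 0)"
      unfolding n0 using t by (subst n) (auto simp flip: sum_subtractf intro!: sum.cong)
    then have "(n_poles v t f - n_poles v 0 f) / t = (\<Sum>z\<in>A. (if z \<noteq> 0 \<and> v z \<le> t then p z else 0) / t)"
      by (simp add: sum_divide_distrib)
    then show "(\<Sum>z\<in>A. if z = 0 then 0 else p z * (if v z \<le> t then 1 / t else 0)) =
        (n_poles v t f - n_poles v 0 f) / t"
      by (auto intro!: sum.cong)
  qed
  then have "integral {0..r} (\<lambda>t. (n_poles v t f - n_poles v 0 f) / t) =
      (\<Sum>z\<in>A. if z = 0 then 0 else p z * (ln r - ln (v z)))"
    by (rule integral_unique)
  then have "N_count v r f = (\<Sum>z\<in>A. if z = 0 then 0 else p z * (ln r - ln (v z)))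
      + (\<Sum>z\<in>A. if z = 0 then p z else 0) * ln r"
    unfolding N_count_def n0 by simp
  also have "\<dots> = (\<Sum>z\<in>A. p z * weight r z)"
    unfolding sum_distrib_right sum.distrib[symmetric] by (intro sum.cong) (auto simp: weight_def)
  finally show ?thesis
    by (simp add: p_def)
qed

text \<open>The first non-vanishing Taylor coefficient at the origin, which takes the place of g(0)
  in Jensen's formula when \<open>g\<close> vanishes there.\<close>

definition lead :: "'k fps \<Rightarrow> 'k" where
  "lead g = fps_nth g (subdegree g)"

lemma lead_mult: "g \<noteq> 0 \<Longrightarrow> h \<noteq> 0 \<Longrightarrow> lead (g * h) = lead g * lead h"
  by (simp add: lead_def)

lemma lead_eq_0_iff [simp]: "lead g = 0 \<longleftrightarrow> g = 0"
  by (auto simp: lead_def)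

lemma lead_lin: "lead (lin z) = (if z = 0 then 1 else - z)"
  by (auto simp: lead_def)

lemma subdegree_shift_lin: "subdegree (shift z (lin a)) = (if a = z then 1 else 0)"
  by (auto simp: shift_lin)

lemma subdegree_shift_mult:
  assumes "entire v g" "entire v h" "g \<noteq> 0" "h \<noteq> 0"
  shows "subdegree (shift z (g * h)) = subdegree (shift z g) + subdegree (shift z h)"
  using assms by (simp add: shift_mult shift_eq_0_iff)

lemma prod_lin_neq_0 [simp]: "prod_list (map lin zs) \<noteq> 0"
  by (induction zs) auto

lemma subdegree_shift_prod_lin: "subdegree (shift z (prod_list (map lin zs))) = count_list zs z"
  by (induction zs) (simp_all add: subdegree_shift_mult subdegree_shift_lin)

lemma zero_order_disc_factors:
  assumes "disc_factors r g zs u m" "v z \<le> r" "0 < r"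
  shows "zero_order v g z = count_list zs z"
proof -
  have u: "g = prod_list (map lin zs) * u" "entire v u" "dominant r u 0 m"
    using assms(1) by (auto simp: disc_factors_def)
  have "0 < m"
    using u(3) by (simp add: dominant_def)
  then have "value_at u z \<noteq> 0" "u \<noteq> 0"
    using v_value_at_dominant_0[OF u(2,3) assms(2,3)] by auto
  then have "subdegree (shift z u) = 0" "g \<noteq> 0"
    using u(1) by auto
  then show ?thesis
    using u \<open>u \<noteq> 0\<close> by (simp add: zero_order_eq_subdegree subdegree_shift_mult subdegree_shift_prod_lin)
qed

text \<open>A factor \<open>fps_X\<close> has leading coefficient 1 and contributes 0, in accordance
  with the convention for the origin in \<open>weight\<close>.\<close>

lemma ln_v_lead_prod_lin:
  "ln (v (lead (prod_list (map lin zs)))) = sum_list (map (\<lambda>z. if z = 0 then 0 else ln (v z)) zs)"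
proof (induction zs)
  case Nil
  then show ?case
    by (simp add: lead_def)
next
  case (Cons z zs)
  then show ?case
    by (auto simp: lead_mult lead_lin v_mult ln_mult)
qed

end

context nonarch_closed
begin

text \<open>With \<open>k\<close> zeros in the disc, the zero-free factor has constant absolute
  value \<open>m / r ^ k\<close> there. Comparing leading coefficients leaves
  \<open>k * ln r\<close> minus the logarithms of the non-zero zeros, which is the sum of the
  weights.\<close>

lemma
  assumes g: "entire v g" "g \<noteq> 0" and r: "0 < r"
  shows finite_zeros: "finite {z. v z \<le> r \<and> zero_order v g z \<noteq> 0}"
    and Jensen_entire: "\<lbrakk>finite A; {z. v z \<le> r \<and> zero_order v g z \<noteq> 0} \<subseteq> A; \<And>z. z \<in> A \<Longrightarrow> v z \<le> r\<rbrakk> \<Longrightarrow>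
      ln (mu_entire v r g) = (\<Sum>z\<in>A. real (zero_order v g z) * weight r z) + ln (v (lead g))"
proof -
  obtain k m where d: "dominant r g k m"
    using ex_dominant[OF g r] by blast
  obtain zs u where zs: "length zs = k" "disc_factors r g zs u (m / r ^ k)"
    using entire_disc_factors[OF g(1) d r] by blast
  then have u: "g = prod_list (map lin zs) * u" "entire v u" "dominant r u 0 (m / r ^ k)"
    by (auto simp: disc_factors_def)
  have m: "0 < m"
    using d by (simp add: dominant_def)
  note ord = zero_order_disc_factors[OF zs(2) _ r]
  have "v z \<le> r" if "z \<in> set zs" for z
    using zs(2) that by (auto simp: disc_factors_def)
  then have "z \<in> set zs \<longleftrightarrow> v z \<le> r \<and> zero_order v g z \<noteq> 0" for z
    using ord[of z] count_list_0_iff[of zs z] by metis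
  then have Z: "{z. v z \<le> r \<and> zero_order v g z \<noteq> 0} = set zs"
    by blast
  then show "finite {z. v z \<le> r \<and> zero_order v g z \<noteq> 0}"
    by simp
  assume "finite A" "{z. v z \<le> r \<and> zero_order v g z \<noteq> 0} \<subseteq> A" "\<And>z. z \<in> A \<Longrightarrow> v z \<le> r"
  then have A: "finite A" "set zs \<subseteq> A" "\<And>z. z \<in> A \<Longrightarrow> v z \<le> r"
    using Z by simp_all
  have "u \<noteq> 0"
    using g(2) u(1) by auto
  have u0: "v (fps_nth u 0) = m / r ^ k"
    using u(3) by (simp add: dominant_def)
  then have "fps_nth u 0 \<noteq> 0"
    using m r by auto
  \<comment> \<open>The factor \<open>u\<close> does not vanish at the origin, so its leading
    coefficient is its constant term.\<close>
  then have "lead u = fps_nth u 0"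
    by (simp add: lead_def subdegree_eq_0)
  then have "ln (v (lead u)) = ln m - k * ln r"
    using u0 m r by (simp add: ln_div ln_realpow)
  moreover have "ln (v (lead g)) = ln (v (lead (prod_list (map lin zs)))) + ln (v (lead u))"
    using \<open>u \<noteq> 0\<close> by (simp add: u(1) lead_mult v_mult ln_mult)
  moreover have "sum_list (map (weight r) zs)
      = k * ln r - sum_list (map (\<lambda>z. if z = 0 then 0 else ln (v z)) zs)"
    unfolding zs(1)[symmetric] by (induction zs) (auto simp: weight_def algebra_simps)
  moreover have "sum_list (map (weight r) zs) = (\<Sum>z\<in>A. real (zero_order v g z) * weight r z)"
    unfolding sum_list_eq_sum_count[OF A(1,2)] using A(3) ord by (intro sum.cong) auto
  ultimately show "ln (mu_entire v r g) = (\<Sum>z\<in>A. real (zero_order v g z) * weight r z) + ln (v (lead g))"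
    using dominant_mu_entire[OF d] by (simp add: ln_v_lead_prod_lin)
qed

end

section \<open>Meromorphic functions\<close>

definition pole_order :: "'a::field_char_0 fls \<Rightarrow> nat" where
  "pole_order x = nat (- fls_subdegree x)"

lemma pole_order_0 [simp]: "pole_order 0 = 0"
  and pole_order_1 [simp]: "pole_order 1 = 0"
  and pole_order_const [simp]: "pole_order (fls_const c) = 0"
  by (simp_all add: pole_order_def)

lemma pole_order_add: "pole_order (x + y) \<le> max (pole_order x) (pole_order y)"
  using fls_plus_subdegree[of x y] by (cases "x + y = 0") (auto simp: pole_order_def)

lemma pole_order_mult: "pole_order (x * y) \<le> pole_order x + pole_order y"
  by (cases "x = 0 \<or> y = 0") (auto simp: pole_order_def)

lemma pole_order_power: "pole_order (x ^ n) \<le> n * pole_order x"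
proof (induction n)
  case (Suc n)
  then show ?case
    using pole_order_mult[of x "x ^ n"] by simp
qed simp

lemma pole_order_prod: "pole_order (\<Prod>i\<in>A. h i) \<le> (\<Sum>i\<in>A. pole_order (h i))"
proof (induction A rule: infinite_finite_induct)
  case (insert i A)
  then show ?case
    using pole_order_mult[of "h i" "\<Prod>i\<in>A. h i"] by simp
qed simp_all

lemma pole_order_sum: "pole_order (\<Sum>i\<in>A. h i) \<le> (\<Sum>i\<in>A. pole_order (h i))"
proof (induction A rule: infinite_finite_induct)
  case (insert i A)
  then show ?case
    using pole_order_add[of "h i" "\<Sum>i\<in>A. h i"] by simp
qed simp_all

text \<open>The factor 2, cruder than adding 1, keeps regular points regular without a case distinction.\<close>
lemma pole_order_deriv: "pole_order (fls_deriv x) \<le> 2 * pole_order x"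
  using fls_deriv_subdegree0[of x] fls_subdegree_deriv[of x]
  by (cases "fls_subdegree x = 0") (auto simp: pole_order_def)

lemma pole_order_deriv_funpow: "pole_order ((fls_deriv ^^ j) x) \<le> 2 ^ j * pole_order x"
proof (induction j)
  case (Suc j)
  then show ?case
    using pole_order_deriv[of "(fls_deriv ^^ j) x"] by simp
qed simp

text \<open>Bounding the order of a sum by the sum of the orders keeps the estimate linear, so it
  passes termwise to counting functions. The weight \<open>2 ^ j\<close> comes from \<open>j\<close>
  differentiations.\<close>

lemma pole_order_diff_poly_eval:
  "pole_order (diff_poly_eval n I c a)
    \<le> (\<Sum>i\<in>I. pole_order (c i) + (\<Sum>j\<le>n. i j * 2 ^ j) * pole_order a)"
  unfolding diff_poly_eval_def
proof (rule order_trans[OF pole_order_sum sum_mono])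
  fix i
  have "pole_order (\<Prod>j\<le>n. (fls_deriv ^^ j) a ^ i j) \<le> (\<Sum>j\<le>n. pole_order ((fls_deriv ^^ j) a ^ i j))"
    by (rule pole_order_prod)
  also have "\<dots> \<le> (\<Sum>j\<le>n. i j * (2 ^ j * pole_order a))"
    by (intro sum_mono order_trans[OF pole_order_power mult_left_mono] pole_order_deriv_funpow) simp
  also have "\<dots> = (\<Sum>j\<le>n. i j * 2 ^ j) * pole_order a"
    by (simp add: sum_distrib_right mult.assoc)
  finally show "pole_order (c i * (\<Prod>j\<le>n. (fls_deriv ^^ j) a ^ i j))
      \<le> pole_order (c i) + (\<Sum>j\<le>n. i j * 2 ^ j) * pole_order a"
    using pole_order_mult[of "c i" "\<Prod>j\<le>n. (fls_deriv ^^ j) a ^ i j"] by linarith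
qed

context nonarch
begin

section \<open>The differential field of meromorphic functions\<close>

abbreviation quot :: "'k fps \<Rightarrow> 'k fps \<Rightarrow> 'k fls" where
  "quot g h \<equiv> fps_to_fls g / fps_to_fls h"

lemma meromE:
  assumes "f \<in> merom v"
  obtains g h where "entire v g" "entire v h" "h \<noteq> 0" "f = quot g h"
  using assms unfolding merom_def by blast

lemma meromI: "entire v g \<Longrightarrow> entire v h \<Longrightarrow> h \<noteq> 0 \<Longrightarrow> quot g h \<in> merom v"
  unfolding merom_def by blast

lemma quot_add: "h \<noteq> 0 \<Longrightarrow> h' \<noteq> 0 \<Longrightarrow> quot g h + quot g' h' = quot (g * h' + g' * h) (h * h')"
  by (simp add: fls_times_fps_to_fls add_frac_eq)

lemma quot_mult: "quot g h * quot g' h' = quot (g * g') (h * h')"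
  by (simp add: fls_times_fps_to_fls)

lemma quot_deriv:
  assumes "h \<noteq> 0"
  shows "fls_deriv (quot g h) = quot (fps_deriv g * h - g * fps_deriv h) (h * h)"
proof -
  define f where "f = quot g h"
  have "fps_to_fls g = f * fps_to_fls h"
    using assms by (simp add: f_def)
  then have *: "fls_deriv (fps_to_fls g) = fls_deriv f * fps_to_fls h + f * fls_deriv (fps_to_fls h)"
    by (simp add: add.commute)
  have "fps_to_fls (fps_deriv g * h - g * fps_deriv h) = fls_deriv f * (fps_to_fls h * fps_to_fls h)"
    using * assms by (simp add: fls_times_fps_to_fls f_def algebra_simps flip: fls_deriv_fps_to_fls)
  then show ?thesis
    using assms by (simp add: fls_times_fps_to_fls f_def)
qed

lemma quot_eq_iff: "h \<noteq> 0 \<Longrightarrow> h' \<noteq> 0 \<Longrightarrow> quot g h = quot g' h' \<longleftrightarrow> g * h' = g' * h"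
  by (simp add: frac_eq_eq flip: fls_times_fps_to_fls)

lemma const_eq_quot: "fls_const c = quot (fps_const c) 1"
  by simp

lemma merom_const [simp]: "fls_const c \<in> merom v"
  unfolding const_eq_quot by (rule meromI) auto

lemma merom_0 [simp]: "0 \<in> merom v"
  using merom_const[of 0] by simp

lemma merom_1 [simp]: "1 \<in> merom v"
  using merom_const[of 1] by simp

lemma merom_add [simp]: "x \<in> merom v \<Longrightarrow> y \<in> merom v \<Longrightarrow> x + y \<in> merom v"
  by (elim meromE) (simp add: quot_add meromI del: fps_to_fls_plus)

lemma merom_mult [simp]: "x \<in> merom v \<Longrightarrow> y \<in> merom v \<Longrightarrow> x * y \<in> merom v"
  by (elim meromE) (simp only: quot_mult meromI entire_mult mult_eq_0_iff simp_thms)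

lemma merom_minus [simp]: "x \<in> merom v \<Longrightarrow> - x \<in> merom v"
  using merom_mult[OF merom_const[of "- 1"], of x] by simp

lemma merom_diff [simp]: "x \<in> merom v \<Longrightarrow> y \<in> merom v \<Longrightarrow> x - y \<in> merom v"
  using merom_add[of x "- y"] by simp

lemma merom_inverse [simp]:
  assumes "x \<in> merom v"
  shows "inverse x \<in> merom v"
proof (cases "x = 0")
  case False
  obtain g h where "entire v g" "entire v h" "h \<noteq> 0" "x = quot g h"
    using assms by (rule meromE)
  then show ?thesis
    using False meromI[of h g] by auto
qed simp

lemma merom_deriv [simp]: "x \<in> merom v \<Longrightarrow> fls_deriv x \<in> merom v"
  by (elim meromE) (simp add: quot_deriv meromI del: fps_to_fls_minus)

lemma merom_deriv_funpow [simp]: "x \<in> merom v \<Longrightarrow> (fls_deriv ^^ j) x \<in> merom v"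
  by (induction j) auto

lemma merom_power [simp]: "x \<in> merom v \<Longrightarrow> x ^ n \<in> merom v"
  by (induction n) auto

lemma merom_prod [simp]: "(\<And>i. i \<in> A \<Longrightarrow> h i \<in> merom v) \<Longrightarrow> (\<Prod>i\<in>A. h i) \<in> merom v"
  by (induction A rule: infinite_finite_induct) auto

lemma merom_sum [simp]: "(\<And>i. i \<in> A \<Longrightarrow> h i \<in> merom v) \<Longrightarrow> (\<Sum>i\<in>A. h i) \<in> merom v"
  by (induction A rule: infinite_finite_induct) auto

lemma merom_diff_poly_eval [simp]:
  "(\<And>i. i \<in> I \<Longrightarrow> c i \<in> merom v) \<Longrightarrow> a \<in> merom v \<Longrightarrow> diff_poly_eval n I c a \<in> merom v"
  unfolding diff_poly_eval_def by simp

text \<open>The Laurent expansion at \<open>z\<close>, obtained by shifting numerator and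
  denominator. The choice mirrors that in \<open>mu\<close> and is resolved in the same way, by
  cross-multiplication.\<close>

definition expansion :: "'k \<Rightarrow> 'k fls \<Rightarrow> 'k fls" where
  "expansion z f = (SOME q. \<exists>g h. entire v g \<and> entire v h \<and> h \<noteq> 0 \<and> f = quot g h \<and>
     q = quot (shift z g) (shift z h))"

lemma expansion_quot:
  assumes "entire v g" "entire v h" "h \<noteq> 0"
  shows "expansion z (quot g h) = quot (shift z g) (shift z h)"
  unfolding expansion_def
proof (rule some_equality)
  show "\<exists>g' h'. entire v g' \<and> entire v h' \<and> h' \<noteq> 0 \<and> quot g h = quot g' h' \<and>
      quot (shift z g) (shift z h) = quot (shift z g') (shift z h')"
    using assms by blast
next
  fix q assume "\<exists>g' h'. entire v g' \<and> entire v h' \<and> h' \<noteq> 0 \<and> quot g h = quot g' h' \<and>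
      q = quot (shift z g') (shift z h')"
  then obtain g' h' where *: "entire v g'" "entire v h'" "h' \<noteq> 0" "quot g h = quot g' h'"
      "q = quot (shift z g') (shift z h')"
    by blast
  \<comment> \<open>The identity between the two representations is an equation of entire series, so
    the homomorphism property of the shift transports it.\<close>
  have "shift z (g * h') = shift z (g' * h)"
    using *(4) assms(3) *(3) by (simp add: quot_eq_iff)
  then have "shift z g' * shift z h = shift z g * shift z h'"
    using assms * by (simp add: shift_mult)
  then show "q = quot (shift z g) (shift z h)"
    using assms * by (simp add: quot_eq_iff shift_eq_0_iff)
qed

lemma expansion_const [simp]: "expansion z (fls_const c) = fls_const c"
  using expansion_quot[of "fps_const c" 1 z] by simp

lemma expansion_0 [simp]: "expansion z 0 = 0"
  using expansion_const[of z 0] by simp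

lemma expansion_1 [simp]: "expansion z 1 = 1"
  using expansion_const[of z 1] by simp

lemma expansion_add:
  assumes "x \<in> merom v" "y \<in> merom v"
  shows "expansion z (x + y) = expansion z x + expansion z y"
proof -
  obtain g h where x: "entire v g" "entire v h" "h \<noteq> 0" "x = quot g h"
    using assms(1) by (rule meromE)
  obtain g' h' where y: "entire v g'" "entire v h'" "h' \<noteq> 0" "y = quot g' h'"
    using assms(2) by (rule meromE)
  show ?thesis
    using x y by (simp add: quot_add expansion_quot shift_mult shift_add shift_eq_0_iff
        del: fps_to_fls_plus)
qed

lemma expansion_mult:
  assumes "x \<in> merom v" "y \<in> merom v"
  shows "expansion z (x * y) = expansion z x * expansion z y"
proof -
  obtain g h where x: "entire v g" "entire v h" "h \<noteq> 0" "x = quot g h"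
    using assms(1) by (rule meromE)
  obtain g' h' where y: "entire v g'" "entire v h'" "h' \<noteq> 0" "y = quot g' h'"
    using assms(2) by (rule meromE)
  show ?thesis
    unfolding x(4) y(4) quot_mult using x y
    by (simp only: expansion_quot entire_mult mult_eq_0_iff simp_thms shift_mult quot_mult)
qed

lemma expansion_deriv:
  assumes "x \<in> merom v"
  shows "expansion z (fls_deriv x) = fls_deriv (expansion z x)"
proof -
  obtain g h where x: "entire v g" "entire v h" "h \<noteq> 0" "x = quot g h"
    using assms(1) by (rule meromE)
  show ?thesis
    using x by (simp add: quot_deriv expansion_quot shift_mult shift_diff shift_deriv shift_eq_0_iff
        del: fps_to_fls_minus)
qed

lemma expansion_deriv_funpow:
  "x \<in> merom v \<Longrightarrow> expansion z ((fls_deriv ^^ j) x) = (fls_deriv ^^ j) (expansion z x)"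
  by (induction j) (simp_all add: expansion_deriv)

lemma expansion_power: "x \<in> merom v \<Longrightarrow> expansion z (x ^ n) = expansion z x ^ n"
  by (induction n) (simp_all add: expansion_mult)

lemma expansion_prod:
  "(\<And>i. i \<in> A \<Longrightarrow> h i \<in> merom v) \<Longrightarrow> expansion z (\<Prod>i\<in>A. h i) = (\<Prod>i\<in>A. expansion z (h i))"
  by (induction A rule: infinite_finite_induct) (simp_all add: expansion_mult)

lemma expansion_sum:
  "(\<And>i. i \<in> A \<Longrightarrow> h i \<in> merom v) \<Longrightarrow> expansion z (\<Sum>i\<in>A. h i) = (\<Sum>i\<in>A. expansion z (h i))"
  by (induction A rule: infinite_finite_induct) (simp_all add: expansion_add)

lemma expansion_diff_poly_eval:
  assumes "\<And>i. i \<in> I \<Longrightarrow> c i \<in> merom v" "a \<in> merom v"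
  shows "expansion z (diff_poly_eval n I c a) = diff_poly_eval n I (\<lambda>i. expansion z (c i)) (expansion z a)"
  unfolding diff_poly_eval_def using assms
  by (simp add: expansion_sum expansion_mult expansion_prod expansion_power expansion_deriv_funpow)

lemma expansion_at_0: "x \<in> merom v \<Longrightarrow> expansion 0 x = x"
  by (elim meromE) (simp add: expansion_quot shift_by_0)

lemma fls_subdegree_expansion:
  assumes "entire v g" "entire v h" "g \<noteq> 0" "h \<noteq> 0"
  shows "fls_subdegree (expansion z (quot g h)) = int (zero_order v g z) - int (zero_order v h z)"
  using assms by (simp add: expansion_quot fls_divide_subdegree shift_eq_0_iff fls_subdegree_fls_to_fps
      zero_order_eq_subdegree)

text \<open>Common zeros of numerator and denominator cancel in the difference of their orders,
  which is the subdegree of the expansion up to sign. Every representation therefore gives the same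
  number.\<close>

lemma pole_mult_eq:
  assumes "f \<in> merom v"
  shows "pole_mult v f z = pole_order (expansion z f)"
proof (cases "f = 0")
  case False
  have "(SOME m. \<exists>g h. entire v g \<and> entire v h \<and> h \<noteq> 0 \<and> g \<noteq> 0 \<and> f = quot g h \<and>
        m = nat (int (zero_order v h z) - int (zero_order v g z))) = pole_order (expansion z f)"
  proof (rule some_equality)
    obtain g h where gh: "entire v g" "entire v h" "h \<noteq> 0" "f = quot g h"
      using assms by (rule meromE)
    then have "g \<noteq> 0"
      using False by auto
    then show "\<exists>g h. entire v g \<and> entire v h \<and> h \<noteq> 0 \<and> g \<noteq> 0 \<and> f = quot g h \<and>
        pole_order (expansion z f) = nat (int (zero_order v h z) - int (zero_order v g z))"
      using gh by (intro exI[of _ g] exI[of _ h]) (simp add: pole_order_def fls_subdegree_expansion)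
  qed (auto simp: pole_order_def fls_subdegree_expansion)
  then show ?thesis
    using False by (simp add: pole_mult_def)
qed (simp add: pole_mult_def)

section \<open>The Gauss norm of meromorphic functions\<close>

lemma mu_quot:
  assumes "entire v g" "entire v h" "h \<noteq> 0" "0 < r"
  shows "mu v r (quot g h) = mu_entire v r g / mu_entire v r h"
  unfolding mu_def
proof (rule some_equality)
  show "\<exists>g' h'. entire v g' \<and> entire v h' \<and> h' \<noteq> 0 \<and> quot g h = quot g' h' \<and>
      mu_entire v r g / mu_entire v r h = mu_entire v r g' / mu_entire v r h'"
    using assms by blast
next
  fix q assume "\<exists>g' h'. entire v g' \<and> entire v h' \<and> h' \<noteq> 0 \<and> quot g h = quot g' h' \<and>
      q = mu_entire v r g' / mu_entire v r h'"
  then obtain g' h' where *: "entire v g'" "entire v h'" "h' \<noteq> 0" "quot g h = quot g' h'"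
      "q = mu_entire v r g' / mu_entire v r h'"
    by blast
  have "mu_entire v r (g * h') = mu_entire v r (g' * h)"
    using *(4) assms(3) *(3) by (simp add: quot_eq_iff)
  then have "mu_entire v r g' * mu_entire v r h = mu_entire v r g * mu_entire v r h'"
    using assms * by (simp add: mu_entire_mult)
  then show "q = mu_entire v r g / mu_entire v r h"
    using mu_entire_pos[OF assms(2,3,4)] mu_entire_pos[OF *(2,3) assms(4)] *(5)
    by (simp add: frac_eq_eq)
qed

lemma mu_const [simp]: "0 < r \<Longrightarrow> mu v r (fls_const c) = v c"
proof -
  assume r: "0 < r"
  have "mu_entire v r (fps_const c) = v c" for c
    unfolding mu_entire_def using r by (intro cSup_eq_maximum) (auto intro: image_eqI[of _ _ 0])
  from this[of c] this[of 1] show ?thesis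
    using r mu_quot[of "fps_const c" 1 r] by simp
qed

lemma mu_0 [simp]: "0 < r \<Longrightarrow> mu v r 0 = 0"
  using mu_const[of r 0] by simp

lemma mu_1 [simp]: "0 < r \<Longrightarrow> mu v r 1 = 1"
  using mu_const[of r 1] by simp

lemma mu_pos:
  assumes "x \<in> merom v" "x \<noteq> 0" "0 < r"
  shows "0 < mu v r x"
proof -
  obtain g h where x: "entire v g" "entire v h" "h \<noteq> 0" "x = quot g h"
    using assms(1) by (rule meromE)
  then have "g \<noteq> 0"
    using assms(2) by auto
  then show ?thesis
    using x assms(3) by (simp add: mu_quot mu_entire_pos)
qed

lemma mu_nonneg: "x \<in> merom v \<Longrightarrow> 0 < r \<Longrightarrow> 0 \<le> mu v r x"
  using mu_pos[of x r] by (cases "x = 0") auto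

lemma mu_mult:
  assumes "x \<in> merom v" "y \<in> merom v" "0 < r"
  shows "mu v r (x * y) = mu v r x * mu v r y"
proof -
  obtain g h where x: "entire v g" "entire v h" "h \<noteq> 0" "x = quot g h"
    using assms(1) by (rule meromE)
  obtain g' h' where y: "entire v g'" "entire v h'" "h' \<noteq> 0" "y = quot g' h'"
    using assms(2) by (rule meromE)
  show ?thesis
    unfolding x(4) y(4) quot_mult using x y assms(3) by (simp add: mu_quot mu_entire_mult)
qed

lemma mu_add:
  assumes "x \<in> merom v" "y \<in> merom v" "0 < r"
  shows "mu v r (x + y) \<le> max (mu v r x) (mu v r y)"
proof -
  obtain g h where x: "entire v g" "entire v h" "h \<noteq> 0" "x = quot g h"
    using assms(1) by (rule meromE)
  obtain g' h' where y: "entire v g'" "entire v h'" "h' \<noteq> 0" "y = quot g' h'"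
    using assms(2) by (rule meromE)
  define H where "H = mu_entire v r h * mu_entire v r h'"
  have pos: "0 < mu_entire v r h" "0 < mu_entire v r h'" "0 < H"
    using x y assms(3) by (simp_all add: mu_entire_pos H_def)
  have "mu v r (x + y) = mu_entire v r (g * h' + g' * h) / H"
    unfolding x(4) y(4) quot_add[OF x(3) y(3)] H_def
    using x y assms(3) by (subst mu_quot) (simp_all add: mu_entire_mult)
  also have "\<dots> \<le> max (mu_entire v r (g * h')) (mu_entire v r (g' * h)) / H"
    using pos x y assms(3) by (intro divide_right_mono mu_entire_add) auto
  also have "\<dots> = max (mu_entire v r (g * h') / H) (mu_entire v r (g' * h) / H)"
    using pos by (simp add: max_divide_distrib_right)
  also have "\<dots> = max (mu v r x) (mu v r y)"
    using x y assms(3) pos by (simp add: mu_quot mu_entire_mult H_def)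
  finally show ?thesis .
qed

lemma mu_minus [simp]:
  assumes "x \<in> merom v" "0 < r"
  shows "mu v r (- x) = mu v r x"
  using mu_mult[OF merom_const[of "- 1"] assms] assms(2) mu_const[of r "- 1"] by simp

lemma mu_diff:
  "x \<in> merom v \<Longrightarrow> y \<in> merom v \<Longrightarrow> 0 < r \<Longrightarrow> mu v r (x - y) \<le> max (mu v r x) (mu v r y)"
  using mu_add[of x "- y" r] by simp

lemma mu_inverse:
  assumes "x \<in> merom v" "0 < r"
  shows "mu v r (inverse x) = inverse (mu v r x)"
proof (cases "x = 0")
  case False
  then have "mu v r x * mu v r (inverse x) = 1"
    using assms mu_mult[of x "inverse x" r] by simp
  then show ?thesis
    by (simp add: inverse_unique)
qed (use assms in simp)

text \<open>In the quotient rule each product in the numerator has norm at most that of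
  \<open>g\<close> times that of \<open>h\<close>, because \<open>r \<ge> 1\<close>; the ultrametric
  inequality adds no factor for the difference.\<close>

lemma mu_deriv:
  assumes "x \<in> merom v" "1 \<le> r"
  shows "mu v r (fls_deriv x) \<le> mu v r x"
proof -
  have r: "0 < r"
    using assms(2) by simp
  obtain g h where x: "entire v g" "entire v h" "h \<noteq> 0" "x = quot g h"
    using assms(1) by (rule meromE)
  have der: "mu_entire v r (fps_deriv g) \<le> mu_entire v r g" if "entire v g" for g
  proof -
    have "mu_entire v r (fps_deriv g) \<le> mu_entire v r g / r"
      by (rule mu_entire_le) (rule mu_entire_deriv[OF that r])
    also have "\<dots> \<le> mu_entire v r g"
      using mu_entire_nonneg[OF that r] assms(2) divide_left_mono[of 1 r "mu_entire v r g"] by simp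
    finally show ?thesis .
  qed
  have nn: "0 \<le> mu_entire v r g" "0 < mu_entire v r h"
    using x r by (simp_all add: mu_entire_nonneg mu_entire_pos)
  have "mu_entire v r (fps_deriv g * h - g * fps_deriv h) \<le>
      max (mu_entire v r (fps_deriv g * h)) (mu_entire v r (g * fps_deriv h))"
    using mu_entire_add[of "fps_deriv g * h" "- (g * fps_deriv h)" r] x r by simp
  also have "\<dots> \<le> mu_entire v r g * mu_entire v r h"
    using x r nn by (auto simp: mu_entire_mult intro!: mult_mono der mu_entire_nonneg)
  finally have "mu_entire v r (fps_deriv g * h - g * fps_deriv h) \<le> mu_entire v r g * mu_entire v r h" .
  then have "mu_entire v r (fps_deriv g * h - g * fps_deriv h) / (mu_entire v r h * mu_entire v r h)
      \<le> mu_entire v r g * mu_entire v r h / (mu_entire v r h * mu_entire v r h)"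
    using nn by (intro divide_right_mono) auto
  then have "mu_entire v r (fps_deriv g * h - g * fps_deriv h) / (mu_entire v r h * mu_entire v r h)
      \<le> mu_entire v r g / mu_entire v r h"
    using nn by simp
  moreover have "mu v r (fls_deriv x) =
      mu_entire v r (fps_deriv g * h - g * fps_deriv h) / (mu_entire v r h * mu_entire v r h)"
    unfolding x(4) quot_deriv[OF x(3)] using x r by (subst mu_quot) (simp_all add: mu_entire_mult)
  ultimately show ?thesis
    using x r by (simp add: mu_quot)
qed

lemma mu_deriv_funpow:
  assumes "x \<in> merom v" "1 \<le> r"
  shows "mu v r ((fls_deriv ^^ j) x) \<le> mu v r x"
proof (induction j)
  case (Suc j)
  then show ?case
    using mu_deriv[OF merom_deriv_funpow[OF assms(1), of j] assms(2)] by simp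
qed simp

end

section \<open>The estimate\<close>

context nonarch
begin

lemma pole_mult_quot:
  assumes "entire v g" "entire v h" "g \<noteq> 0" "h \<noteq> 0"
  shows "pole_mult v (quot g h) z = zero_order v h z - zero_order v g z"
  using assms by (simp add: pole_mult_eq meromI pole_order_def fls_subdegree_expansion nat_minus_as_int)

lemma m_prox_nonneg: "0 \<le> m_prox v r f"
  by (simp add: m_prox_def)

lemma m_prox_eq_ln_max:
  assumes "f \<in> merom v" "0 < r"
  shows "m_prox v r f = ln (max 1 (mu v r f))"
proof (cases "f = 0")
  case False
  then show ?thesis
    using mu_pos[OF assms(1) _ assms(2)] by (auto simp: m_prox_def max_def ln_ge_zero_iff)
qed (use assms in \<open>simp add: m_prox_def\<close>)

lemma mu_sum_le:
  assumes "\<And>i. i \<in> A \<Longrightarrow> h i \<in> merom v" "\<And>i. i \<in> A \<Longrightarrow> mu v r (h i) \<le> B" "0 \<le> B" "0 < r"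
  shows "mu v r (\<Sum>i\<in>A. h i) \<le> B"
  using assms(1,2)
proof (induction A rule: infinite_finite_induct)
  case (insert i A)
  have "mu v r (\<Sum>i\<in>A. h i) \<le> B" "mu v r (h i) \<le> B"
    using insert by auto
  then have "max (mu v r (h i)) (mu v r (\<Sum>i\<in>A. h i)) \<le> B"
    by simp
  moreover have "mu v r (h i + (\<Sum>i\<in>A. h i)) \<le> max (mu v r (h i)) (mu v r (\<Sum>i\<in>A. h i))"
    using insert.prems assms(4) by (intro mu_add) auto
  ultimately have "mu v r (h i + (\<Sum>i\<in>A. h i)) \<le> B"
    by (rule order_trans[rotated])
  then show ?case
    using insert.hyps by simp
qed (use assms in auto)

text \<open>The error \<open>d\<close> is measured relative to the bounds \<open>M\<close> and
  \<open>M'\<close>, so that it does not grow when factors are multiplied.\<close>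

lemma mu_mult_diff_le:
  assumes "x \<in> merom v" "x' \<in> merom v" "y \<in> merom v" "y' \<in> merom v" "0 < r"
    and "mu v r x \<le> M" "mu v r y' \<le> M'" "mu v r (x - x') \<le> d * M" "mu v r (y - y') \<le> d * M'" "0 \<le> M" "0 \<le> M'"
  shows "mu v r (x * y - x' * y') \<le> d * (M * M')"
proof -
  have "mu v r (x * (y - y')) \<le> M * (d * M')"
    using assms mu_nonneg by (simp add: mu_mult mult_mono)
  moreover have "mu v r ((x - x') * y') \<le> d * M * M'"
  proof -
    have "0 \<le> d * M"
      using assms mu_nonneg[of "x - x'" r] by simp
    then show ?thesis
      using assms mu_nonneg by (simp add: mu_mult mult_mono)
  qed
  moreover have "x * y - x' * y' = x * (y - y') + (x - x') * y'"
    by (simp add: algebra_simps)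
  ultimately show ?thesis
    using mu_add[of "x * (y - y')" "(x - x') * y'" r] assms by (simp add: mult_ac)
qed

lemma mu_power_le:
  assumes "x \<in> merom v" "mu v r x \<le> M" "0 < r"
  shows "mu v r (x ^ e) \<le> M ^ e"
proof (induction e)
  case (Suc e)
  have "0 \<le> M"
    using mu_nonneg[OF assms(1,3)] assms(2) by simp
  then show ?case
    using Suc assms mu_nonneg by (simp add: mu_mult mult_mono)
qed (use assms in simp)

lemma mu_power_diff_le:
  assumes "x \<in> merom v" "y \<in> merom v" "mu v r x \<le> M" "mu v r y \<le> M" "mu v r (x - y) \<le> d"
    "1 \<le> M" "0 < r"
  shows "mu v r (x ^ e - y ^ e) \<le> d * M ^ e"
proof (induction e)
  case 0
  then show ?case
    using assms mu_nonneg[of "x - y" r] by simp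
next
  case (Suc e)
  have "0 \<le> d"
    using assms mu_nonneg[of "x - y" r] by simp
  \<comment> \<open>Here \<open>1 \<le> M\<close> turns the absolute error of one factor into a
    relative one.\<close>
  then have "d \<le> d * M"
    using assms(6) mult_left_mono[of 1 M d] by simp
  then have "mu v r (x * x ^ e - y * y ^ e) \<le> d * (M * M ^ e)"
    using Suc assms by (intro mu_mult_diff_le mu_power_le) auto
  then show ?case
    by simp
qed

lemma mu_prod_power_diff_le:
  assumes "finite A" and "\<And>j. j \<in> A \<Longrightarrow> x j \<in> merom v" "\<And>j. j \<in> A \<Longrightarrow> y j \<in> merom v"
    and "\<And>j. j \<in> A \<Longrightarrow> mu v r (x j) \<le> M" "\<And>j. j \<in> A \<Longrightarrow> mu v r (y j) \<le> M"
    and "\<And>j. j \<in> A \<Longrightarrow> mu v r (x j - y j) \<le> d" and "1 \<le> M" "0 \<le> d" "0 < r"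
  shows "mu v r ((\<Prod>j\<in>A. x j ^ e j) - (\<Prod>j\<in>A. y j ^ e j)) \<le> d * M ^ (\<Sum>j\<in>A. e j)"
    and "mu v r (\<Prod>j\<in>A. y j ^ e j) \<le> M ^ (\<Sum>j\<in>A. e j)"
proof -
  \<comment> \<open>Both bounds go through one induction, because the error of an enlarged product
    involves the size of the remaining \<open>y\<close>-product.\<close>
  have "mu v r ((\<Prod>j\<in>A. x j ^ e j) - (\<Prod>j\<in>A. y j ^ e j)) \<le> d * M ^ (\<Sum>j\<in>A. e j) \<and>
      mu v r (\<Prod>j\<in>A. y j ^ e j) \<le> M ^ (\<Sum>j\<in>A. e j)"
    using assms(1-6)
  proof (induction A rule: finite_induct)
    case empty
    then show ?case
      using assms by simp
  next
    case (insert j A)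
    have IH: "mu v r ((\<Prod>j\<in>A. x j ^ e j) - (\<Prod>j\<in>A. y j ^ e j)) \<le> d * M ^ (\<Sum>j\<in>A. e j)"
      "mu v r (\<Prod>j\<in>A. y j ^ e j) \<le> M ^ (\<Sum>j\<in>A. e j)"
      using insert by simp_all
    have j: "x j \<in> merom v" "y j \<in> merom v" "mu v r (x j) \<le> M" "mu v r (y j) \<le> M" "mu v r (x j - y j) \<le> d"
      using insert.prems by simp_all
    have "mu v r (x j ^ e j * (\<Prod>j\<in>A. x j ^ e j) - y j ^ e j * (\<Prod>j\<in>A. y j ^ e j))
        \<le> d * (M ^ e j * M ^ (\<Sum>j\<in>A. e j))"
      using insert.prems IH j assms(7,9) by (intro mu_mult_diff_le mu_power_le mu_power_diff_le) auto
    moreover have "mu v r (y j ^ e j * (\<Prod>j\<in>A. y j ^ e j)) \<le> M ^ e j * M ^ (\<Sum>j\<in>A. e j)"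
      using insert.prems IH j assms(7,9) mu_nonneg mu_power_le by (simp add: mu_mult mult_mono)
    ultimately show ?case
      using insert.hyps by (simp add: power_add)
  qed
  then show "mu v r ((\<Prod>j\<in>A. x j ^ e j) - (\<Prod>j\<in>A. y j ^ e j)) \<le> d * M ^ (\<Sum>j\<in>A. e j)"
    and "mu v r (\<Prod>j\<in>A. y j ^ e j) \<le> M ^ (\<Sum>j\<in>A. e j)"
    by blast+
qed

lemma fls_deriv_funpow_diff: "(fls_deriv ^^ j) (x - y) = (fls_deriv ^^ j) x - (fls_deriv ^^ j) (y :: 'k fls)"
  by (induction j) simp_all

text \<open>The truncation \<open>max 0\<close> keeps the right-hand side non-negative, which is all
  that is required when \<open>f - a\<close> has norm at least 1 and the left-hand side
  vanishes.\<close>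

lemma m_prox_inverse_diff_le:
  assumes r: "1 \<le> r" and I: "finite I" and c: "\<And>i. i \<in> I \<Longrightarrow> c i \<in> merom v"
    and f: "f \<in> merom v" and a: "a \<in> merom v"
    and sol: "diff_poly_eval n I c f = 0" and nsol: "diff_poly_eval n I c a \<noteq> 0"
  shows "m_prox v r (1 / (f - a)) \<le> (\<Sum>i\<in>I. m_prox v r (c i)) + real (\<Sum>i\<in>I. \<Sum>j\<le>n. i j) * m_prox v r a
     + max 0 (- ln (mu v r (diff_poly_eval n I c a)))"
proof -
  define \<Omega> where "\<Omega> = diff_poly_eval n I c"
  define g where "g = f - a"
  define M where "M = max 1 (mu v r a)"
  \<comment> \<open>The degrees of all monomials are added, so that one exponent serves every
    \<open>i\<close>; \<open>M \<ge> 1\<close> makes enlarging the exponent harmless.\<close>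
  define K where "K = (\<Sum>i\<in>I. \<Sum>j\<le>n. i j)"
  define B where "B = (\<Prod>i\<in>I. max 1 (mu v r (c i))) * M ^ K"
  have r0: "0 < r"
    using r by simp
  have "f \<noteq> a"
    using sol nsol by auto
  then have g: "g \<in> merom v" "g \<noteq> 0"
    using f a by (auto simp: g_def)
  have mug: "0 < mu v r g" "mu v r (1 / g) = 1 / mu v r g"
    using mu_pos[OF g r0] mu_inverse[OF g(1) r0] by (simp_all add: divide_inverse)
  have M: "1 \<le> M" "mu v r a \<le> M"
    by (auto simp: M_def)
  have lnB: "ln B = (\<Sum>i\<in>I. m_prox v r (c i)) + K * m_prox v r a"
  proof -
    have "ln (\<Prod>i\<in>I. max 1 (mu v r (c i))) = (\<Sum>i\<in>I. ln (max 1 (mu v r (c i))))"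
      by (rule ln_prod) (use I in auto)
    moreover have "0 < (\<Prod>i\<in>I. max 1 (mu v r (c i)))"
      by (rule prod_pos) auto
    ultimately show ?thesis
      using M(1) c a r0 by (simp add: B_def ln_mult ln_realpow m_prox_eq_ln_max M_def)
  qed
  have Bpos: "0 < B"
    using M(1) by (auto simp: B_def intro!: mult_pos_pos prod_pos)
  have nn: "0 \<le> (\<Sum>i\<in>I. m_prox v r (c i)) + K * m_prox v r a"
    using m_prox_nonneg by (intro add_nonneg_nonneg sum_nonneg mult_nonneg_nonneg) auto
  show ?thesis
  proof (cases "mu v r g \<ge> 1")
    case True
    then have "m_prox v r (1 / g) = 0"
      using mug by (simp add: m_prox_def ln_div)
    then show ?thesis
      using nn by (simp add: g_def K_def)
  next
    case False
    \<comment> \<open>As \<open>f = a + g\<close> with \<open>g\<close> of norm below 1, the single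
      bound \<open>M\<close> covers \<open>a\<close>, \<open>f\<close> and all their
      derivatives.\<close>
    have "mu v r f \<le> max (mu v r a) (mu v r g)"
      using mu_add[OF a g(1) r0] by (simp add: g_def)
    then have muf: "mu v r f \<le> M"
      using False by (auto simp: M_def)
    have diff_le: "mu v r (c i * ((\<Prod>j\<le>n. (fls_deriv ^^ j) a ^ i j) - (\<Prod>j\<le>n. (fls_deriv ^^ j) f ^ i j)))
        \<le> mu v r g * B" if i: "i \<in> I" for i
    proof -
      have "mu v r ((\<Prod>j\<le>n. (fls_deriv ^^ j) a ^ i j) - (\<Prod>j\<le>n. (fls_deriv ^^ j) f ^ i j))
          \<le> mu v r g * M ^ (\<Sum>j\<le>n. i j)"
      proof (rule mu_prod_power_diff_le(1))
        fix j
        show "mu v r ((fls_deriv ^^ j) a) \<le> M" "mu v r ((fls_deriv ^^ j) f) \<le> M"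
          using order_trans[OF mu_deriv_funpow[OF a r] M(2)] order_trans[OF mu_deriv_funpow[OF f r] muf] .
        have "mu v r ((fls_deriv ^^ j) a - (fls_deriv ^^ j) f) = mu v r (- (fls_deriv ^^ j) g)"
          by (simp add: g_def fls_deriv_funpow_diff)
        then show "mu v r ((fls_deriv ^^ j) a - (fls_deriv ^^ j) f) \<le> mu v r g"
          using mu_deriv_funpow[OF g(1) r] g(1) r0 by simp
      qed (use f a M(1) mug(1) r0 in auto)
      also have "\<dots> \<le> mu v r g * M ^ K"
        unfolding K_def using M(1) mug(1) i I
        by (intro mult_left_mono power_increasing member_le_sum[of i I "\<lambda>i. \<Sum>j\<le>n. i j"]) auto
      finally have "mu v r (c i) * mu v r ((\<Prod>j\<le>n. (fls_deriv ^^ j) a ^ i j) - (\<Prod>j\<le>n. (fls_deriv ^^ j) f ^ i j))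
          \<le> (\<Prod>i\<in>I. max 1 (mu v r (c i))) * (mu v r g * M ^ K)"
      proof (rule mult_mono[rotated])
        have "mu v r (c i) \<le> (\<Prod>i\<in>{i}. max 1 (mu v r (c i)))"
          by simp
        also have "\<dots> \<le> (\<Prod>i\<in>I. max 1 (mu v r (c i)))"
          using i I by (intro prod_mono2) auto
        finally show "mu v r (c i) \<le> (\<Prod>i\<in>I. max 1 (mu v r (c i)))" .
        show "0 \<le> (\<Prod>i\<in>I. max 1 (mu v r (c i)))"
          by (intro prod_nonneg) auto
      qed (use f a r0 in \<open>auto intro!: mu_nonneg merom_diff merom_prod\<close>)
      then show ?thesis
        using c[OF i] f a r0 by (simp add: mu_mult B_def mult_ac)
    qed
    have "\<Omega> a = \<Omega> a - \<Omega> f"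
      using sol by (simp add: \<Omega>_def)
    also have "\<dots> = (\<Sum>i\<in>I. c i * ((\<Prod>j\<le>n. (fls_deriv ^^ j) a ^ i j) - (\<Prod>j\<le>n. (fls_deriv ^^ j) f ^ i j)))"
      by (simp add: \<Omega>_def diff_poly_eval_def sum_subtractf right_diff_distrib)
    finally have "mu v r (\<Omega> a) \<le> mu v r g * B"
      using c f a mug(1) Bpos r0 diff_le by (auto intro!: mu_sum_le)
    moreover have "0 < mu v r (\<Omega> a)"
      unfolding \<Omega>_def using c a nsol r0 by (intro mu_pos) auto
    ultimately have "ln (mu v r (\<Omega> a)) \<le> ln (mu v r g * B)"
      by simp
    then have "ln (mu v r (\<Omega> a)) \<le> ln (mu v r g) + ln B"
      using mug(1) Bpos by (simp add: ln_mult)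
    then have "ln (mu v r (1 / g)) \<le> ln B - ln (mu v r (\<Omega> a))"
      using mug by (simp add: ln_div)
    then show ?thesis
      unfolding m_prox_def[of v r "1 / (f - a)"] using nn lnB by (simp add: g_def K_def \<Omega>_def)
  qed
qed

end

context nonarch_closed
begin

section \<open>Counting functions and growth of the characteristic\<close>

lemma finite_poles:
  assumes "f \<in> merom v" "0 < r"
  shows "finite {z. v z \<le> r \<and> pole_mult v f z \<noteq> 0}"
proof (cases "f = 0")
  case False
  obtain g h where gh: "entire v g" "entire v h" "h \<noteq> 0" "f = quot g h"
    using assms(1) by (rule meromE)
  then have "g \<noteq> 0"
    using False by auto
  then have "{z. v z \<le> r \<and> pole_mult v f z \<noteq> 0} \<subseteq> {z. v z \<le> r \<and> zero_order v h z \<noteq> 0}"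
    using gh by (auto simp: pole_mult_quot)
  then show ?thesis
    using finite_zeros[OF gh(2,3) assms(2)] finite_subset by blast
qed (simp add: pole_mult_def)

lemma N_count_nonneg:
  assumes "f \<in> merom v" "1 \<le> r"
  shows "0 \<le> N_count v r f"
proof -
  have "N_count v r f = (\<Sum>z\<in>{z. v z \<le> r \<and> pole_mult v f z \<noteq> 0}. real (pole_mult v f z) * weight r z)"
    using assms finite_poles by (intro N_count_eq_sum) auto
  also have "\<dots> \<ge> 0"
    using assms(2) weight_nonneg by (intro sum_nonneg mult_nonneg_nonneg) auto
  finally show ?thesis .
qed

lemma N_count_diff_poly_eval_le:
  assumes r: "1 \<le> r" and I: "finite I" and c: "\<And>i. i \<in> I \<Longrightarrow> c i \<in> merom v" and a: "a \<in> merom v"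
  shows "N_count v r (diff_poly_eval n I c a)
    \<le> (\<Sum>i\<in>I. N_count v r (c i)) + real (\<Sum>i\<in>I. \<Sum>j\<le>n. i j * 2 ^ j) * N_count v r a"
proof -
  define F where "F = diff_poly_eval n I c a"
  define K where "K = (\<lambda>i. \<Sum>j\<le>n. i j * (2::nat) ^ j)"
  define P where "P = (\<lambda>f. {z. v z \<le> r \<and> pole_mult v f z \<noteq> 0})"
  \<comment> \<open>One finite set containing the poles of all functions involved turns the
    comparison of counting functions into a pointwise comparison of pole orders.\<close>
  define A where "A = P F \<union> P a \<union> (\<Union>i\<in>I. P (c i))"
  have r0: "0 < r"
    using r by simp
  have F: "F \<in> merom v"
    unfolding F_def using c a by simp
  have fin: "finite A"
    unfolding A_def P_def using finite_poles r0 F a c I by auto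
  have A: "v z \<le> r" if "z \<in> A" for z
    using that by (auto simp: A_def P_def)
  have NF: "N_count v r F = (\<Sum>z\<in>A. real (pole_mult v F z) * weight r z)"
    by (rule N_count_eq_sum[OF r0 fin A]) (auto simp: A_def P_def)
  have Na: "N_count v r a = (\<Sum>z\<in>A. real (pole_mult v a z) * weight r z)"
    by (rule N_count_eq_sum[OF r0 fin A]) (auto simp: A_def P_def)
  have Nc: "N_count v r (c i) = (\<Sum>z\<in>A. real (pole_mult v (c i) z) * weight r z)" if "i \<in> I" for i
    by (rule N_count_eq_sum[OF r0 fin A]) (use that in \<open>auto simp: A_def P_def\<close>)
  have "N_count v r F \<le> (\<Sum>z\<in>A. (\<Sum>i\<in>I. real (pole_mult v (c i) z) + K i * pole_mult v a z) * weight r z)"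
    unfolding NF
  proof (intro sum_mono mult_right_mono weight_nonneg A r)
    fix z
    have "pole_mult v F z \<le> (\<Sum>i\<in>I. pole_order (expansion z (c i)) + K i * pole_order (expansion z a))"
      using pole_order_diff_poly_eval[of n I "\<lambda>i. expansion z (c i)" "expansion z a"] c a
      unfolding pole_mult_eq[OF F] by (simp add: F_def K_def expansion_diff_poly_eval)
    also have "\<dots> = (\<Sum>i\<in>I. pole_mult v (c i) z + K i * pole_mult v a z)"
      using c a by (simp add: pole_mult_eq)
    finally have "real (pole_mult v F z) \<le> real (\<Sum>i\<in>I. pole_mult v (c i) z + K i * pole_mult v a z)"
      by (rule of_nat_mono)
    then show "real (pole_mult v F z) \<le> (\<Sum>i\<in>I. real (pole_mult v (c i) z) + K i * pole_mult v a z)"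
      by simp
  qed
  also have "\<dots> = (\<Sum>z\<in>A. \<Sum>i\<in>I. real (pole_mult v (c i) z) * weight r z + K i * (pole_mult v a z * weight r z))"
    by (simp add: sum_distrib_right distrib_right mult.assoc)
  also have "\<dots> = (\<Sum>i\<in>I. \<Sum>z\<in>A. real (pole_mult v (c i) z) * weight r z + K i * (pole_mult v a z * weight r z))"
    by (rule sum.swap)
  also have "\<dots> = (\<Sum>i\<in>I. N_count v r (c i) + K i * N_count v r a)"
    using Nc Na by (simp add: sum.distrib sum_distrib_left)
  also have "\<dots> = (\<Sum>i\<in>I. N_count v r (c i)) + real (\<Sum>i\<in>I. K i) * N_count v r a"
    by (simp add: sum.distrib sum_distrib_right)
  finally show ?thesis
    by (simp add: F_def K_def)
qed

text \<open>The difference of Jensen's formula for numerator and denominator. The constant comes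
  from their leading coefficients and is fixed before \<open>r\<close>; the origin is put into
  \<open>A\<close> so that its contribution can be singled out.\<close>

lemma Jensen_merom:
  assumes "f \<in> merom v" "f \<noteq> 0"
  shows "\<exists>C. \<forall>r>0. \<exists>A. finite A \<and> 0 \<in> A \<and> (\<forall>z\<in>A. v z \<le> r) \<and> {z. v z \<le> r \<and> pole_mult v f z \<noteq> 0} \<subseteq> A \<and>
    ln (mu v r f) = (\<Sum>z\<in>A. real_of_int (fls_subdegree (expansion z f)) * weight r z) + C"
proof -
  obtain g h where gh: "entire v g" "entire v h" "h \<noteq> 0" "f = quot g h"
    using assms(1) by (rule meromE)
  then have g0: "g \<noteq> 0"
    using assms(2) by auto
  have sub: "fls_subdegree (expansion z f) = int (zero_order v g z) - int (zero_order v h z)" for z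
    using gh g0 by (simp add: fls_subdegree_expansion)
  show ?thesis
  proof (intro exI allI impI conjI)
    fix r :: real assume r: "0 < r"
    define A where "A = {z. v z \<le> r \<and> zero_order v g z \<noteq> 0} \<union> {z. v z \<le> r \<and> zero_order v h z \<noteq> 0} \<union> {0}"
    show fin: "finite A"
      unfolding A_def using finite_zeros gh g0 r by simp
    show "0 \<in> A"
      by (simp add: A_def)
    show A: "\<forall>z\<in>A. v z \<le> r"
      using r by (auto simp: A_def)
    show "{z. v z \<le> r \<and> pole_mult v f z \<noteq> 0} \<subseteq> A"
      unfolding A_def gh(4) using gh g0 by (auto simp: pole_mult_quot)
    have gA: "{z. v z \<le> r \<and> zero_order v g z \<noteq> 0} \<subseteq> A" and hA: "{z. v z \<le> r \<and> zero_order v h z \<noteq> 0} \<subseteq> A"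
      unfolding A_def by blast+
    have "ln (mu_entire v r g) = (\<Sum>z\<in>A. real (zero_order v g z) * weight r z) + ln (v (lead g))"
      by (rule Jensen_entire[OF gh(1) g0 r fin gA]) (use A in blast)
    moreover have "ln (mu_entire v r h) = (\<Sum>z\<in>A. real (zero_order v h z) * weight r z) + ln (v (lead h))"
      by (rule Jensen_entire[OF gh(2,3) r fin hA]) (use A in blast)
    moreover have "ln (mu v r f) = ln (mu_entire v r g) - ln (mu_entire v r h)"
      using gh r mu_entire_pos[OF gh(1) g0 r] mu_entire_pos[OF gh(2,3) r] by (simp add: mu_quot ln_div)
    ultimately show "ln (mu v r f) = (\<Sum>z\<in>A. real_of_int (fls_subdegree (expansion z f)) * weight r z)
        + (ln (v (lead g)) - ln (v (lead h)))"
      by (simp add: sub sum_subtractf left_diff_distrib)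
  qed
qed

text \<open>In Jensen's formula zeros only increase \<open>ln (mu v r f)\<close>, so discarding them
  leaves the poles.\<close>

lemma minus_ln_mu_le_N_count:
  assumes "f \<in> merom v" "f \<noteq> 0"
  shows "\<exists>C. \<forall>r\<ge>1. - ln (mu v r f) \<le> N_count v r f + C"
proof -
  obtain C where C: "\<And>r. 0 < r \<Longrightarrow> \<exists>A. finite A \<and> 0 \<in> A \<and> (\<forall>z\<in>A. v z \<le> r) \<and> {z. v z \<le> r \<and> pole_mult v f z \<noteq> 0} \<subseteq> A \<and>
      ln (mu v r f) = (\<Sum>z\<in>A. real_of_int (fls_subdegree (expansion z f)) * weight r z) + C"
    using Jensen_merom[OF assms] by blast
  have "- ln (mu v r f) \<le> N_count v r f + - C" if r: "1 \<le> r" for r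
  proof -
    obtain A where A: "finite A" "\<forall>z\<in>A. v z \<le> r" "{z. v z \<le> r \<and> pole_mult v f z \<noteq> 0} \<subseteq> A"
      "ln (mu v r f) = (\<Sum>z\<in>A. real_of_int (fls_subdegree (expansion z f)) * weight r z) + C"
      using C[of r] r by auto
    have "N_count v r f = (\<Sum>z\<in>A. real (pole_mult v f z) * weight r z)"
      using A r by (intro N_count_eq_sum) auto
    also have "\<dots> \<ge> (\<Sum>z\<in>A. - real_of_int (fls_subdegree (expansion z f)) * weight r z)"
      using A r by (intro sum_mono mult_right_mono weight_nonneg)
        (auto simp: pole_mult_eq[OF assms(1)] pole_order_def)
    finally show ?thesis
      using A(4) by (simp add: sum_negf)
  qed
  then show ?thesis
    by blast
qed

text \<open>A pole contributes its weight, which is \<open>ln r\<close> up to a constant. Without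
  poles, subtracting the value at the origin creates a zero there; Jensen's formula then has only
  non-negative contributions from zeros, and the origin alone gives \<open>ln r\<close>.\<close>

lemma T_char_ge_ln:
  assumes f: "f \<in> merom v" and nonconst: "\<And>b. f \<noteq> fls_const b"
  shows "\<exists>C R. \<forall>r\<ge>R. ln r - C \<le> T_char v r f"
proof (cases "\<exists>z. pole_mult v f z \<noteq> 0")
  case True
  then obtain z where z: "pole_mult v f z \<noteq> 0"
    by blast
  have "weight r z \<le> T_char v r f" if r: "max 1 (v z) \<le> r" for r
  proof -
    define A where "A = {z. v z \<le> r \<and> pole_mult v f z \<noteq> 0}"
    have fin: "finite A"
      unfolding A_def using r f by (intro finite_poles) auto
    have "N_count v r f = (\<Sum>z\<in>A. real (pole_mult v f z) * weight r z)"
      using fin r by (intro N_count_eq_sum) (auto simp: A_def)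
    also have "\<dots> \<ge> real (pole_mult v f z) * weight r z"
      using fin r z by (intro member_le_sum mult_nonneg_nonneg weight_nonneg) (auto simp: A_def)
    also have "real (pole_mult v f z) * weight r z \<ge> 1 * weight r z"
      using z r by (intro mult_right_mono weight_nonneg) auto
    finally show ?thesis
      using m_prox_nonneg[of r f] by (simp add: T_char_def)
  qed
  then show ?thesis
    unfolding weight_def by blast
next
  case False
  define b where "b = fls_nth f 0"
  define F where "F = f - fls_const b"
  have F: "F \<in> merom v" "F \<noteq> 0"
    using f nonconst[of b] by (auto simp: F_def)
  have nopole: "0 \<le> fls_subdegree (expansion z F)" for z
  proof -
    have "pole_order (expansion z f) = 0"
      using False f by (simp add: pole_mult_eq)
    moreover have "expansion z F = expansion z f + fls_const (- b)"
    proof -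
      have "F = f + fls_const (- b)"
        by (simp add: F_def)
      then show ?thesis
        by (simp only: expansion_add[OF f merom_const] expansion_const)
    qed
    ultimately show ?thesis
      using pole_order_add[of "expansion z f" "fls_const (- b)"] by (simp add: pole_order_def del: fls_const_uminus)
  qed
  have sub0: "1 \<le> fls_subdegree F"
  proof (rule fls_subdegree_geI[OF F(2)])
    fix k :: int assume k: "k < 1"
    have "k < fls_subdegree F \<or> k = 0"
      using k nopole[of 0] expansion_at_0[OF F(1)] by auto
    moreover have "fls_nth F 0 = 0"
      by (simp add: F_def b_def)
    ultimately show "fls_nth F k = 0"
      by auto
  qed
  obtain C where C: "\<And>r. 0 < r \<Longrightarrow> \<exists>A. finite A \<and> 0 \<in> A \<and> (\<forall>z\<in>A. v z \<le> r) \<and> {z. v z \<le> r \<and> pole_mult v F z \<noteq> 0} \<subseteq> A \<and>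
      ln (mu v r F) = (\<Sum>z\<in>A. real_of_int (fls_subdegree (expansion z F)) * weight r z) + C"
    using Jensen_merom[OF F] by blast
  have lnF: "ln r + C \<le> ln (mu v r F)" if r: "1 \<le> r" for r
  proof -
    obtain A where A: "finite A" "0 \<in> A" "\<forall>z\<in>A. v z \<le> r"
      "ln (mu v r F) = (\<Sum>z\<in>A. real_of_int (fls_subdegree (expansion z F)) * weight r z) + C"
      using C[of r] r by auto
    have "1 * ln r \<le> real_of_int (fls_subdegree (expansion 0 F)) * weight r 0"
      using sub0 expansion_at_0[OF F(1)] r unfolding weight_def by (intro mult_mono) auto
    also have "\<dots> \<le> (\<Sum>z\<in>A. real_of_int (fls_subdegree (expansion z F)) * weight r z)"
      using A r nopole weight_nonneg by (intro member_le_sum mult_nonneg_nonneg) auto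
    finally show ?thesis
      using A(4) by simp
  qed
  \<comment> \<open>Beyond \<open>R\<close> the lower bound \<open>ln r + C\<close> exceeds
    \<open>ln (v b)\<close>. For \<open>b \<noteq> 0\<close> this shows that \<open>F\<close> has
    larger norm than the constant \<open>b\<close>; for \<open>b = 0\<close> positivity of the norm
    suffices. Then the norm of \<open>f\<close> is at least that of \<open>F\<close>.\<close>
  define R where "R = max 1 (exp (ln (v b) - C) + 1)"
  have "ln r - (- C) \<le> T_char v r f" if r: "R \<le> r" for r
  proof -
    have r1: "1 \<le> r" "exp (ln (v b) - C) < r"
      using r unfolding R_def max.bounded_iff by linarith+
    have muF: "0 < mu v r F"
      using F r1 by (intro mu_pos) auto
    have "ln (v b) - C < ln r"
      using r1 ln_less_cancel_iff[of "exp (ln (v b) - C)" r] by simp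
    then have lt: "ln (v b) < ln (mu v r F)"
      using lnF[OF r1(1)] by linarith
    have "v b < mu v r F"
    proof (cases "b = 0")
      case False
      then have "0 < v b"
        by simp
      then show ?thesis
        using lt muF ln_less_cancel_iff by blast
    qed (use muF in simp)
    moreover have "mu v r F \<le> max (mu v r f) (v b)"
      using mu_diff[OF f merom_const[of b], of r] r1 by (simp add: F_def)
    ultimately have "mu v r F \<le> mu v r f"
      by auto
    then have "ln (mu v r F) \<le> ln (mu v r f)"
      using muF by simp
    then have "ln r + C \<le> m_prox v r f"
      using lnF[OF r1(1)] by (simp add: m_prox_def)
    then show ?thesis
      using N_count_nonneg[OF f r1(1)] by (simp add: T_char_def)
  qed
  then show ?thesis
    by blast
qed

lemma T_char_at_top:
  assumes "f \<in> merom v" "\<And>b. f \<noteq> fls_const b"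
  shows "filterlim (\<lambda>r. T_char v r f) at_top at_top"
proof -
  obtain C R where CR: "\<And>r. r \<ge> R \<Longrightarrow> ln r - C \<le> T_char v r f"
    using T_char_ge_ln[OF assms] by blast
  have "filterlim (\<lambda>r::real. - C + ln r) at_top at_top"
    by (intro filterlim_tendsto_add_at_top[OF tendsto_const] ln_at_top)
  moreover have "eventually (\<lambda>r. - C + ln r \<le> T_char v r f) at_top"
    using eventually_ge_at_top[of R] by eventually_elim (use CR in force)
  ultimately show ?thesis
    by (rule filterlim_at_top_mono)
qed

lemma m_prox_inverse_diff_le_T_char:
  assumes I: "finite I" and c: "\<And>i. i \<in> I \<Longrightarrow> c i \<in> merom v"
    and f: "f \<in> merom v" and a: "a \<in> merom v"
    and sol: "diff_poly_eval n I c f = 0" and nsol: "diff_poly_eval n I c a \<noteq> 0"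
  shows "\<exists>K C. \<forall>r\<ge>1. m_prox v r (1 / (f - a)) \<le> (\<Sum>i\<in>I. T_char v r (c i)) + K * T_char v r a + C"
proof -
  define F where "F = diff_poly_eval n I c a"
  define K where "K = real (\<Sum>i\<in>I. \<Sum>j\<le>n. i j)"
  define K' where "K' = real (\<Sum>i\<in>I. \<Sum>j\<le>n. i j * 2 ^ j)"
  have K: "0 \<le> K" "0 \<le> K'"
    unfolding K_def K'_def by (rule of_nat_0_le_iff)+
  have F: "F \<in> merom v" "F \<noteq> 0"
    using c a nsol by (auto simp: F_def)
  obtain C where C: "\<And>r. 1 \<le> r \<Longrightarrow> - ln (mu v r F) \<le> N_count v r F + C"
    using minus_ln_mu_le_N_count[OF F] by blast
  have "m_prox v r (1 / (f - a)) \<le> (\<Sum>i\<in>I. T_char v r (c i)) + (K + K') * T_char v r a + \<bar>C\<bar>" if r: "1 \<le> r" for r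
  proof -
    have N: "N_count v r F \<le> (\<Sum>i\<in>I. N_count v r (c i)) + K' * N_count v r a"
      using N_count_diff_poly_eval_le[of r I c a n] r I c a by (simp add: F_def K'_def)
    have nn: "0 \<le> (\<Sum>i\<in>I. N_count v r (c i)) + K' * N_count v r a"
      using N_count_nonneg r c a K by (intro add_nonneg_nonneg sum_nonneg mult_nonneg_nonneg) auto
    have "m_prox v r (1 / (f - a)) \<le> (\<Sum>i\<in>I. m_prox v r (c i)) + K * m_prox v r a + max 0 (- ln (mu v r F))"
      using m_prox_inverse_diff_le[OF r I c f a sol nsol] by (simp add: F_def K_def)
    \<comment> \<open>The bound on the counting function is non-negative, so replacing
      \<open>C\<close> by \<open>\<bar>C\<bar>\<close> makes the whole bound dominate 0 as
      well.\<close>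
    also have "max 0 (- ln (mu v r F)) \<le> (\<Sum>i\<in>I. N_count v r (c i)) + K' * N_count v r a + \<bar>C\<bar>"
      using C[OF r] N nn by (auto intro: order_trans)
    \<comment> \<open>For the coefficients, proximity and counting parts recombine into the
      characteristic with factor 1. For \<open>a\<close> the factors \<open>K\<close> and
      \<open>K'\<close> differ, so each part is enlarged to the full characteristic.\<close>
    also have "(\<Sum>i\<in>I. m_prox v r (c i)) + K * m_prox v r a +
        ((\<Sum>i\<in>I. N_count v r (c i)) + K' * N_count v r a + \<bar>C\<bar>) =
        (\<Sum>i\<in>I. T_char v r (c i)) + K * m_prox v r a + K' * N_count v r a + \<bar>C\<bar>"
      by (simp add: T_char_def sum.distrib)
    also have "\<dots> \<le> (\<Sum>i\<in>I. T_char v r (c i)) + K * T_char v r a + K' * T_char v r a + \<bar>C\<bar>"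
      using K m_prox_nonneg[of r a] N_count_nonneg[OF a r]
      by (intro add_mono mult_left_mono order_refl) (auto simp: T_char_def)
    finally show ?thesis
      by (simp add: distrib_right)
  qed
  then show ?thesis
    by blast
qed

end

theorem theorem1p5:
  fixes v :: "'k::field_char_0 \<Rightarrow> real"
    and n :: nat
    and I :: "(nat \<Rightarrow> nat) set"
    and c :: "(nat \<Rightarrow> nat) \<Rightarrow> 'k fls"
    and f a :: "'k fls"
  assumes "alg_closed_field TYPE('k)"
    and "complete_nonarch_abs v"
    and "n > 0"
    and "finite I"
    and "\<forall>i\<in>I. \<forall>j>n. i j = 0"
    and "\<forall>i\<in>I. c i \<in> merom v"
    and "\<exists>i\<in>I. c i \<noteq> 0"
    and "f \<in> merom v"
    and "\<forall>b. f \<noteq> fls_const b"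
    and "diff_poly_eval n I c f = 0"
    and "(\<lambda>r. \<Sum>i\<in>I. T_char v r (c i)) \<in> o(\<lambda>r. T_char v r f)"
    and "a \<in> merom v"
    and "(\<lambda>r. T_char v r a) \<in> o(\<lambda>r. T_char v r f)"
    and "diff_poly_eval n I c a \<noteq> 0"
  shows "(\<lambda>r. m_prox v r (1 / (f - a))) \<in> o(\<lambda>r. T_char v r f)"
proof -
  interpret nonarch_closed v
    by unfold_locales (use assms in auto)
  obtain K C where KC: "\<And>r. 1 \<le> r \<Longrightarrow>
      m_prox v r (1 / (f - a)) \<le> (\<Sum>i\<in>I. T_char v r (c i)) + K * T_char v r a + C"
    using m_prox_inverse_diff_le_T_char[of I c f a n] assms by blast
  have T: "filterlim (\<lambda>r. T_char v r f) at_top at_top"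
    using T_char_at_top assms by blast
  have "(\<lambda>r. C) \<in> o(\<lambda>r. T_char v r f)"
  proof (rule smalloI_tendsto)
    show "((\<lambda>r. C / T_char v r f) \<longlongrightarrow> 0) at_top"
      by (rule real_tendsto_divide_at_top[OF tendsto_const T])
    have "eventually (\<lambda>r. 0 < T_char v r f) at_top"
      using T by (simp add: filterlim_at_top_dense)
    then show "eventually (\<lambda>r. T_char v r f \<noteq> 0) at_top"
      by eventually_elim simp
  qed
  moreover have "(\<lambda>r. K * T_char v r a) \<in> o(\<lambda>r. T_char v r f)"
    using assms(13) by (cases "K = 0") simp_all
  ultimately have small: "(\<lambda>r. (\<Sum>i\<in>I. T_char v r (c i)) + K * T_char v r a + C) \<in> o(\<lambda>r. T_char v r f)"
    using assms(11) by (intro sum_in_smallo)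
  \<comment> \<open>Since \<open>m_prox\<close> is non-negative, the one-sided estimate bounds its
    absolute value.\<close>
  have "(\<lambda>r. m_prox v r (1 / (f - a))) \<in> O(\<lambda>r. (\<Sum>i\<in>I. T_char v r (c i)) + K * T_char v r a + C)"
  proof (rule bigoI[of _ 1])
    show "eventually (\<lambda>r. norm (m_prox v r (1 / (f - a)))
        \<le> 1 * norm ((\<Sum>i\<in>I. T_char v r (c i)) + K * T_char v r a + C)) at_top"
      using eventually_ge_at_top[of 1]
    proof eventually_elim
      case (elim r)
      then show ?case
        using KC[OF elim] m_prox_nonneg[of r "1 / (f - a)"] by simp
    qed
  qed
  then show ?thesis
    using small by (rule landau_o.big_small_trans)
qed

end
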